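(* Let $R$ be a regular domain, let $\mathbf x=x_1,\dots,x_d$ be a generalized regular system of parameters of $R$, and let $I=(\mathbf x^{\mathbf a_1},\dots,\mathbf x^{\mathbf a_s})$ be an ideal generated by monomials in $\mathbf x$. Then for every $w\in\mathbb Q_{\geqslant0}$, the ideal $\overline{I^w}$ is generated by the monomials $\mathbf x^{\mathbf e}$ with $\mathbf e\in\mathbb Z^d_{\geqslant0}\cap w\operatorname{NP}(I)$.
   Context: A generalized regular system of parameters of a regular domain $R$ is a permutable regular sequence $\mathbf x=x_1,\dots,x_d$ such that for every subsequence $\mathbf x'=x_{i_1},\dots,x_{i_r}$ of $\mathbf x$ the ring $R/(\mathbf x')$ is again a regular domain. For $\mathbf a=(a_1,\dots,a_d)\in\mathbb Z^d_{\geqslant0}$, $\mathbf x^{\mathbf a}:=x_1^{a_1}\cdots x_d^{a_d}$. The Newton polyhedron is $\operatorname{NP}(I):=\operatorname{conv}(\mathbf a_1,\dots,\mathbf a_s)+\mathbb R^d_{\geqslant0}$. For $w=p/q\in\mathbb Q_{\geqslant0}$, $\overline{I^w}:=\{x\in R\mid x^q\in\overline{I^p}\}$, where the overline denotes integral closure. *)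

theory Defs
  imports "HOL-Analysis.Analysis" "HOL-Algebra.Algebra" "HOL-Combinatorics.Permutations"
begin

definition prime_height :: "('a, 'b) ring_scheme \<Rightarrow> 'a set \<Rightarrow> enat" where
  "prime_height R P = Sup {enat (length Ps - 1) | Ps. Ps \<noteq> [] \<and> last Ps = P \<and>
      sorted_wrt (\<subset>) Ps \<and> (\<forall>Q \<in> set Ps. primeideal Q R)}"

text \<open>Minimal number of generators of the maximal ideal P R_P of the localization R_P.
  (a_1/1,...,a_n/1) = P R_P  iff  every p in P satisfies t p in (a_1..a_n) for some t not in P.\<close>
definition loc_num_gens :: "('a, 'b) ring_scheme \<Rightarrow> 'a set \<Rightarrow> nat" where
  "loc_num_gens R P = (LEAST n. \<exists>as. length as = n \<and> set as \<subseteq> P \<and>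
      (\<forall>p\<in>P. \<exists>t \<in> carrier R - P. t \<otimes>\<^bsub>R\<^esub> p \<in> genideal R (set as)))"

text \<open>Regular ring: Noetherian, and every localization R_P at a prime P is a regular
  local ring, i.e. embedding dimension of R_P equals dim R_P = ht P.\<close>
definition regular_ring :: "('a, 'b) ring_scheme \<Rightarrow> bool" where
  "regular_ring R \<longleftrightarrow> cring R \<and> noetherian_ring R \<and>
     (\<forall>P. primeideal P R \<longrightarrow> enat (loc_num_gens R P) = prime_height R P)"

definition regular_domain :: "('a, 'b) ring_scheme \<Rightarrow> bool" where
  "regular_domain R \<longleftrightarrow> regular_ring R \<and> domain R"

definition regular_seq :: "('a, 'b) ring_scheme \<Rightarrow> (nat \<Rightarrow> 'a) \<Rightarrow> nat \<Rightarrow> bool" where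
  "regular_seq R x d \<longleftrightarrow> (\<forall>i<d. x i \<in> carrier R) \<and>
     genideal R (x ` {..<d}) \<noteq> carrier R \<and>
     (\<forall>i<d. \<forall>r \<in> carrier R. x i \<otimes>\<^bsub>R\<^esub> r \<in> genideal R (x ` {..<i}) \<longrightarrow>
                              r \<in> genideal R (x ` {..<i}))"

definition permutable_regular_seq :: "('a, 'b) ring_scheme \<Rightarrow> (nat \<Rightarrow> 'a) \<Rightarrow> nat \<Rightarrow> bool" where
  "permutable_regular_seq R x d \<longleftrightarrow> (\<forall>\<sigma>. \<sigma> permutes {..<d} \<longrightarrow> regular_seq R (x \<circ> \<sigma>) d)"

text \<open>Generalized regular system of parameters. Subsequences correspond to index subsets S.\<close>
definition gen_reg_sop :: "('a, 'b) ring_scheme \<Rightarrow> (nat \<Rightarrow> 'a) \<Rightarrow> nat \<Rightarrow> bool" where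
  "gen_reg_sop R x d \<longleftrightarrow> permutable_regular_seq R x d \<and>
     (\<forall>S \<subseteq> {..<d}. regular_domain (R Quot genideal R (x ` S)))"

definition monomial :: "('a, 'b) ring_scheme \<Rightarrow> (nat \<Rightarrow> 'a) \<Rightarrow> nat \<Rightarrow> (nat \<Rightarrow> nat) \<Rightarrow> 'a" where
  "monomial R x d e = finprod R (\<lambda>i. x i [^]\<^bsub>R\<^esub> e i) {..<d}"

fun ideal_pow :: "('a, 'b) ring_scheme \<Rightarrow> 'a set \<Rightarrow> nat \<Rightarrow> 'a set" where
  "ideal_pow R I 0 = carrier R"
| "ideal_pow R I (Suc n) = ideal_prod R I (ideal_pow R I n)"

definition int_closure :: "('a, 'b) ring_scheme \<Rightarrow> 'a set \<Rightarrow> 'a set" where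
  "int_closure R I = {r \<in> carrier R. \<exists>n\<ge>1. \<exists>c. (\<forall>i\<in>{1..n}. c i \<in> ideal_pow R I i) \<and>
      r [^]\<^bsub>R\<^esub> n \<oplus>\<^bsub>R\<^esub> (finsum R (\<lambda>i. c i \<otimes>\<^bsub>R\<^esub> r [^]\<^bsub>R\<^esub> (n - i)) {1..n}) = \<zero>\<^bsub>R\<^esub>}"

definition rat_power_closure :: "('a, 'b) ring_scheme \<Rightarrow> 'a set \<Rightarrow> rat \<Rightarrow> 'a set" where
  "rat_power_closure R I w = (case quotient_of w of (p, q) \<Rightarrow>
      {r \<in> carrier R. r [^]\<^bsub>R\<^esub> nat q \<in> int_closure R (ideal_pow R I (nat p))})"

text \<open>Newton polyhedron conv(a_1..a_s) + R^d_{\<ge>0}, points of R^d encoded as nat \<Rightarrow> real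
  vanishing outside {..<d}; A is finite, so conv(A) = convex combinations of elements of A.\<close>
definition newton_polyhedron :: "nat \<Rightarrow> (nat \<Rightarrow> nat) set \<Rightarrow> (nat \<Rightarrow> real) set" where
  "newton_polyhedron d A = {y. (\<forall>i\<ge>d. y i = 0) \<and>
     (\<exists>lam :: (nat \<Rightarrow> nat) \<Rightarrow> real. (\<forall>a\<in>A. lam a \<ge> 0) \<and> (\<Sum>a\<in>A. lam a) = 1 \<and>
        (\<forall>i<d. y i \<ge> (\<Sum>a\<in>A. lam a * real (a i))))}"

definition scale_set :: "real \<Rightarrow> (nat \<Rightarrow> real) set \<Rightarrow> (nat \<Rightarrow> real) set" where
  "scale_set c S = (\<lambda>y i. c * y i) ` S"

end

theory Submission
  imports Defs "HOL-Library.Function_Algebras" "HOL-Library.Set_Algebras"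
begin

text \<open>
  Let \<open>K c\<close> be the ideal of the monomials with exponents in \<open>c NP(I)\<close>, and let \<open>s\<close> be the number of
  generators of \<open>I\<close>. A point of \<open>(c + 1) NP(I)\<close> dominates a combination of the \<open>s\<close> vertices with
  coefficients of sum \<open>c + 1\<close>. If \<open>s \<le> c + 1\<close>, one of them is at least \<open>1\<close>, hence \<open>K (c + 1) \<subseteq> I K c\<close>.
  Therefore \<open>K p K s \<subseteq> K (p + s) \<subseteq> I\<^sup>p K s\<close>, and the determinant trick shows that \<open>K p\<close> is integral
  over \<open>I\<^sup>p\<close>.

  Conversely, let \<open>r \<notin> K w\<close>. As the ideals generated by subsets of the parameters are prime, colon
  ideals of monomial ideals by monomials are computed as in a polynomial ring, so \<open>r\<close> is omitted by
  an irreducible component \<open>(x\<^sub>i\<^bsup>b i + 1\<^esup> : i \<in> S)\<close> of \<open>K w\<close>. Choose weights on \<open>S\<close> that separate \<open>b\<close>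
  from the projection of \<open>w NP(I)\<close> and take distinct values on distinct exponents. Then \<open>r\<close> has a
  leading term of weight at most that of \<open>b\<close>. Leading terms are multiplicative, so comparing weights
  contradicts every equation of integral dependence of \<open>r\<^sup>q\<close> on \<open>I\<^sup>p\<close>, where \<open>w = p / q\<close>.
\<close>

no_notation Sum_Type.Plus (infixr \<open><+>\<close> 65)

section \<open>Ideals\<close>

context ring
begin

definition nonzerodivisor_mod :: "'a \<Rightarrow> 'a set \<Rightarrow> bool" where
  "nonzerodivisor_mod y I \<longleftrightarrow> y \<in> carrier R \<and> (\<forall>v\<in>carrier R. y \<otimes> v \<in> I \<longrightarrow> v \<in> I)"

lemma ideal_zero_closed: "ideal I R \<Longrightarrow> \<zero> \<in> I"
  by (simp add: additive_subgroup.zero_closed ideal.axioms(1))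

lemma ideal_add_closed: "ideal I R \<Longrightarrow> a \<in> I \<Longrightarrow> b \<in> I \<Longrightarrow> a \<oplus> b \<in> I"
  by (simp add: additive_subgroup.a_closed ideal.axioms(1))

lemma ideal_minus_closed: "ideal I R \<Longrightarrow> a \<in> I \<Longrightarrow> b \<in> I \<Longrightarrow> a \<ominus> b \<in> I"
  by (simp add: additive_subgroup.a_closed additive_subgroup.a_inv_closed ideal.axioms(1) minus_eq)

lemma finsum_in_ideal:
  assumes "ideal I R" "\<And>b. b \<in> B \<Longrightarrow> f b \<in> I"
  shows "finsum R f B \<in> I"
  using assms(2)
proof (induction B rule: infinite_finite_induct)
  case (insert b B)
  then show ?case
    using ideal.Icarr[OF assms(1)] ideal_add_closed[OF assms(1)] by (subst finsum_insert) auto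
qed (auto simp: ideal_zero_closed[OF assms(1)])

lemma set_add_subset_ideal:
  assumes "ideal K R" "I \<subseteq> K" "J \<subseteq> K"
  shows "I <+> J \<subseteq> K"
  using assms ideal_add_closed[OF assms(1)] unfolding set_add_def' by blast

lemma set_add_mono: "I \<subseteq> I' \<Longrightarrow> J \<subseteq> J' \<Longrightarrow> I <+> J \<subseteq> I' <+> J'"
  unfolding set_add_def' by blast

lemma subset_set_add:
  assumes "ideal I R" "ideal J R"
  shows "I \<subseteq> I <+> J" "J \<subseteq> I <+> J"
  using union_genideal[OF assms] genideal_self[of "I \<union> J"] ideal.Icarr[OF assms(1)]
    ideal.Icarr[OF assms(2)] by (metis Un_subset_iff subsetI)+

lemma Idl_carrier: "B \<subseteq> carrier R \<Longrightarrow> y \<in> Idl B \<Longrightarrow> y \<in> carrier R"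
  by (meson genideal_ideal ideal.Icarr)

lemma Idl_mono: "B \<subseteq> C \<Longrightarrow> C \<subseteq> carrier R \<Longrightarrow> Idl B \<subseteq> Idl C"
  by (meson subset_Idl_subset genideal_self order_trans)

lemma Idl_empty: "Idl {} = {\<zero>}"
  using genideal_minimal[OF zeroideal, of "{}"] ideal_zero_closed[OF genideal_ideal[of "{}"]] by auto

lemma ideal_prod_mono:
  assumes "I \<subseteq> I'" "J \<subseteq> J'"
  shows "I \<cdot> J \<subseteq> I' \<cdot> J'"
proof
  fix a assume "a \<in> I \<cdot> J"
  then show "a \<in> I' \<cdot> J'"
    by induction (use assms in \<open>auto intro: ideal_prod.intros\<close>)
qed

lemma ideal_prod_subset_ideal:
  assumes "ideal K R" "\<And>i j. i \<in> I \<Longrightarrow> j \<in> J \<Longrightarrow> i \<otimes> j \<in> K"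
  shows "I \<cdot> J \<subseteq> K"
proof
  fix a assume "a \<in> I \<cdot> J"
  then show "a \<in> K"
    by induction (auto intro: assms(2) ideal_add_closed[OF assms(1)])
qed

lemma mult_ideal_prod:
  assumes "ideal I R" "ideal J R" "a \<in> carrier R" "\<And>i. i \<in> I \<Longrightarrow> a \<otimes> i \<in> K" "h \<in> I \<cdot> J"
  shows "a \<otimes> h \<in> K \<cdot> J"
  using assms(5)
proof induction
  case (prod i j)
  then have "a \<otimes> (i \<otimes> j) = (a \<otimes> i) \<otimes> j"
    using assms(1-3) by (simp add: ideal.Icarr m_assoc)
  then show ?case using prod assms(4) by (simp add: ideal_prod.prod)
next
  case (sum s t)
  then have "a \<otimes> (s \<oplus> t) = a \<otimes> s \<oplus> a \<otimes> t"
    using assms(1-3) ideal_prod_in_carrier[OF assms(1,2)] by (auto intro: r_distr)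
  then show ?case using sum by (simp add: ideal_prod.sum)
qed

end

context cring
begin

lemma Idl_induct [consumes 2, case_names zero generator add mult]:
  assumes "B \<subseteq> carrier R" "y \<in> Idl B"
    and "P \<zero>" "\<And>b. b \<in> B \<Longrightarrow> P b"
    and add: "\<And>a b. a \<in> carrier R \<Longrightarrow> b \<in> carrier R \<Longrightarrow> P a \<Longrightarrow> P b \<Longrightarrow> P (a \<oplus> b)"
    and mult: "\<And>c a. c \<in> carrier R \<Longrightarrow> a \<in> carrier R \<Longrightarrow> P a \<Longrightarrow> P (c \<otimes> a)"
  shows "P y"
proof -
  let ?I = "{a \<in> carrier R. P a}"
  have "\<ominus> a \<in> ?I" if "a \<in> ?I" for a
    using mult[of "\<ominus> \<one>" a] that by (simp add: l_minus)
  then have "subgroup ?I (add_monoid R)"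
    by (intro subgroup.intro) (use assms in \<open>auto simp flip: a_inv_def\<close>)
  moreover have "P (a \<otimes> c)" if "c \<in> carrier R" "a \<in> carrier R" "P a" for a c
    using mult[OF that] that(1,2) by (simp add: m_comm)
  ultimately have "ideal ?I R"
    using mult by (intro idealI ring_axioms) auto
  moreover have "B \<subseteq> ?I" using assms by auto
  ultimately have "Idl B \<subseteq> ?I" by (rule genideal_minimal)
  then show ?thesis using assms(2) by auto
qed

lemma mult_Idl_subset:
  assumes "B \<subseteq> carrier R" "ideal I R" "c \<in> carrier R" "\<And>b. b \<in> B \<Longrightarrow> c \<otimes> b \<in> I" "y \<in> Idl B"
  shows "c \<otimes> y \<in> I"
  using assms(1,5)
  by (induction rule: Idl_induct)
    (auto simp: assms r_distr m_lcomm ideal_zero_closed ideal_add_closed ideal.I_l_closed)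

lemma Idl_finite_subset:
  assumes "B \<subseteq> carrier R" "y \<in> Idl B"
  obtains C where "finite C" "C \<subseteq> B" "y \<in> Idl C"
proof -
  have "\<exists>C. finite C \<and> C \<subseteq> B \<and> y \<in> Idl C"
    using assms
  proof (induction rule: Idl_induct)
    case zero
    then show ?case using Idl_empty by blast
  next
    case (generator b)
    then show ?case using genideal_self'[of b] assms(1) by blast
  next
    case (add a b)
    then obtain C D where CD: "finite C" "C \<subseteq> B" "a \<in> Idl C" "finite D" "D \<subseteq> B" "b \<in> Idl D"
      by blast
    have "C \<union> D \<subseteq> carrier R" using CD assms(1) by blast
    moreover from this have "a \<in> Idl (C \<union> D)" "b \<in> Idl (C \<union> D)"
      using CD Idl_mono[of C "C \<union> D"] Idl_mono[of D "C \<union> D"] by blast+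
    ultimately have "a \<oplus> b \<in> Idl (C \<union> D)" by (intro ideal_add_closed genideal_ideal)
    then show ?case using CD by (intro exI[of _ "C \<union> D"]) auto
  next
    case (mult c a)
    then obtain C where "finite C" "C \<subseteq> B" "a \<in> Idl C" by blast
    then show ?case using mult.hyps assms(1) by (meson genideal_ideal ideal.I_l_closed order_trans)
  qed
  then show thesis using that by blast
qed

lemma Idl_insert:
  assumes "B \<subseteq> carrier R" "a \<in> carrier R"
  shows "Idl (insert a B) = Idl B <+> PIdl a"
proof
  have insert: "insert a B \<subseteq> carrier R" using assms by simp
  note ideals = genideal_ideal[OF assms(1)] cgenideal_ideal[OF assms(2)]
  have "insert a B \<subseteq> Idl B <+> PIdl a"
    using subset_set_add[OF ideals] genideal_self[OF assms(1)] cgenideal_self[OF assms(2)] by blast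
  then show "Idl (insert a B) \<subseteq> Idl B <+> PIdl a"
    by (rule genideal_minimal[OF add_ideals[OF ideals]])
  show "Idl B <+> PIdl a \<subseteq> Idl (insert a B)"
  proof (rule set_add_subset_ideal[OF genideal_ideal[OF insert]])
    show "Idl B \<subseteq> Idl (insert a B)" using insert by (intro Idl_mono) auto
    show "PIdl a \<subseteq> Idl (insert a B)"
      using genideal_self[OF insert] by (intro cgenideal_minimal genideal_ideal insert) simp
  qed
qed

lemma Idl_insertE:
  assumes "B \<subseteq> carrier R" "a \<in> carrier R" "z \<in> Idl (insert a B)"
  obtains k c where "k \<in> Idl B" "c \<in> carrier R" "z = k \<oplus> c \<otimes> a"
  using assms Idl_insert[of B a] unfolding set_add_def' cgenideal_def by auto

lemma Idl_prod_Idl: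
  assumes "B \<subseteq> carrier R" "C \<subseteq> carrier R"
  shows "(Idl B) \<cdot> (Idl C) = Idl (B <#> C)"
proof
  have BC: "B <#> C \<subseteq> carrier R" using assms by (rule set_mult_closed)
  note ideals = assms[THEN genideal_ideal] genideal_ideal[OF BC]
  show "(Idl B) \<cdot> (Idl C) \<subseteq> Idl (B <#> C)"
  proof (rule ideal_prod_subset_ideal[OF ideals(3)])
    fix y z assume y: "y \<in> Idl B" and z: "z \<in> Idl C"
    have carrier: "y \<in> carrier R" "z \<in> carrier R" using Idl_carrier assms y z by auto
    have "b \<otimes> z \<in> Idl (B <#> C)" if "b \<in> B" for b
      by (rule mult_Idl_subset[OF assms(2) ideals(3) _ _ z])
        (use that assms(1) genideal_self[OF BC] in \<open>auto simp: set_mult_def\<close>)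
    then have "z \<otimes> y \<in> Idl (B <#> C)"
      using assms(1) carrier
      by (intro mult_Idl_subset[OF assms(1) ideals(3) _ _ y]) (auto simp: m_comm subset_iff)
    then show "y \<otimes> z \<in> Idl (B <#> C)" using carrier by (simp add: m_comm)
  qed
  have "B <#> C \<subseteq> (Idl B) \<cdot> (Idl C)"
    using genideal_self[OF assms(1)] genideal_self[OF assms(2)]
    by (auto simp: set_mult_def intro: ideal_prod.prod)
  then show "Idl (B <#> C) \<subseteq> (Idl B) \<cdot> (Idl C)"
    by (rule genideal_minimal[OF ideal_prod_is_ideal[OF ideals(1,2)]])
qed

lemma ideal_prod_left_commute:
  assumes "ideal I R" "ideal J R" "ideal K R"
  shows "I \<cdot> (J \<cdot> K) = J \<cdot> (I \<cdot> K)"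
  using assms by (metis ideal_prod_assoc ideal_prod_commute)

lemma ideal_prod_cgenideal:
  assumes "ideal I R" "a \<in> carrier R"
  shows "I \<cdot> (PIdl a) = (\<lambda>i. i \<otimes> a) ` I"
proof
  show "(\<lambda>i. i \<otimes> a) ` I \<subseteq> I \<cdot> (PIdl a)"
    using cgenideal_self[OF assms(2)] by (auto intro: ideal_prod.prod)
  show "I \<cdot> (PIdl a) \<subseteq> (\<lambda>i. i \<otimes> a) ` I"
  proof
    fix v assume "v \<in> I \<cdot> (PIdl a)"
    then show "v \<in> (\<lambda>i. i \<otimes> a) ` I"
    proof induction
      case (prod i j)
      then obtain c where "c \<in> carrier R" "j = c \<otimes> a" by (auto simp: cgenideal_def)
      with prod show ?case
        using assms
        by (intro image_eqI[of _ _ "i \<otimes> c"]) (simp_all add: m_assoc ideal.Icarr ideal.I_r_closed)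
    next
      case (sum s t)
      then obtain i j where "i \<in> I" "j \<in> I" "s = i \<otimes> a" "t = j \<otimes> a" by blast
      then show ?case
        using assms
        by (intro image_eqI[of _ _ "i \<oplus> j"]) (simp_all add: l_distr ideal.Icarr ideal_add_closed)
    qed
  qed
qed

lemma ideal_pow_ideal: "ideal I R \<Longrightarrow> ideal (ideal_pow R I n) R"
  by (induction n) (simp_all add: oneideal ideal_prod_is_ideal)

lemma ideal_pow_add:
  assumes "ideal I R"
  shows "ideal_pow R I (m + n) = ideal_pow R I m \<cdot> ideal_pow R I n"
proof (induction m)
  case 0
  have "carrier R \<cdot> ideal_pow R I n = ideal_pow R I n"
    using ideal_prod_commute[OF oneideal ideal_pow_ideal[OF assms]] assms
    by (simp add: ideal_prod_one ideal_pow_ideal)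
  then show ?case by simp
next
  case (Suc m)
  then show ?case using assms by (simp add: ideal_prod_assoc ideal_pow_ideal)
qed

lemma pow_in_ideal_pow:
  assumes "ideal I R" "a \<in> I"
  shows "a [^] n \<in> ideal_pow R I n"
proof (induction n)
  case (Suc n)
  then have "a \<otimes> a [^] n \<in> I \<cdot> ideal_pow R I n" by (rule ideal_prod.prod[OF assms(2)])
  moreover have "a \<otimes> a [^] n = a [^] Suc n" using ideal.Icarr[OF assms] by (simp add: m_comm)
  ultimately show ?case by simp
qed simp

lemma ideal_pow_subset_filtration:
  fixes F :: "real \<Rightarrow> 'a set"
  assumes "carrier R \<subseteq> F 0" "\<And>c c'. F c \<cdot> F c' \<subseteq> F (c + c')" "I \<subseteq> F c"
  shows "ideal_pow R I n \<subseteq> F (real n * c)"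
proof (induction n)
  case (Suc n)
  have "I \<cdot> ideal_pow R I n \<subseteq> F (c + real n * c)"
    using ideal_prod_mono[OF assms(3) Suc] assms(2) by (rule order_trans)
  then show ?case by (simp add: algebra_simps)
qed (use assms in simp)

lemma noetherian_Idl_finite_generators:
  assumes "noetherian_ring R" "B \<subseteq> carrier R"
  obtains C where "finite C" "C \<subseteq> B" "Idl C = Idl B"
proof -
  obtain A where A: "A \<subseteq> carrier R" "finite A" "Idl B = Idl A"
    using noetherian_ring.finetely_gen[OF assms(1) genideal_ideal[OF assms(2)]] by metis
  have "\<exists>C. finite C \<and> C \<subseteq> B \<and> a \<in> Idl C" if "a \<in> A" for a
  proof -
    have "a \<in> Idl B" using genideal_self[OF A(1)] that A(3) by blast
    then show ?thesis by (rule Idl_finite_subset[OF assms(2)]) blast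
  qed
  then obtain C where C: "\<And>a. a \<in> A \<Longrightarrow> finite (C a) \<and> C a \<subseteq> B \<and> a \<in> Idl (C a)" by metis
  have sub: "\<Union> (C ` A) \<subseteq> B" using C by blast
  have "a \<in> Idl (\<Union> (C ` A))" if "a \<in> A" for a
  proof -
    have "Idl (C a) \<subseteq> Idl (\<Union> (C ` A))"
      using that sub assms(2) by (intro Idl_mono) auto
    then show ?thesis using C[OF that] by blast
  qed
  then have "Idl B \<subseteq> Idl (\<Union> (C ` A))"
    unfolding A(3) using sub assms(2) by (intro genideal_minimal genideal_ideal) auto
  then have "Idl (\<Union> (C ` A)) = Idl B" using Idl_mono[OF sub assms(2)] by blast
  moreover have "finite (\<Union> (C ` A))" using C A(2) by simp
  ultimately show thesis using that sub by simp
qed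

end

section \<open>The determinant trick\<close>

text \<open>\<open>lower_terms R J y n\<close> consists of the sums \<open>c\<^sub>1 y\<^bsup>n\<^esup> + c\<^sub>2 y\<^bsup>n-1\<^esup> + \<dots> + c\<^sub>n\<^sub>+\<^sub>1\<close> with \<open>c\<^sub>i \<in> J\<^sup>i\<close>.\<close>

definition lower_terms :: "('a, 'b) ring_scheme \<Rightarrow> 'a set \<Rightarrow> 'a \<Rightarrow> nat \<Rightarrow> 'a set" where
  "lower_terms R J y n = J \<cdot>\<^bsub>R\<^esub> ideal_pow R (J <+>\<^bsub>R\<^esub> PIdl\<^bsub>R\<^esub> y) n"

definition monic_terms :: "('a, 'b) ring_scheme \<Rightarrow> 'a set \<Rightarrow> 'a \<Rightarrow> nat \<Rightarrow> 'a set" where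
  "monic_terms R J y n = {y [^]\<^bsub>R\<^esub> Suc n \<oplus>\<^bsub>R\<^esub> v | v. v \<in> lower_terms R J y n}"

locale ideal_and_element = cring R for R (structure) +
  fixes J :: "'a set" and y :: 'a
  assumes J_ideal: "ideal J R" and y_closed: "y \<in> carrier R"
begin

abbreviation lower :: "nat \<Rightarrow> 'a set" where
  "lower \<equiv> lower_terms R J y"

abbreviation monic :: "nat \<Rightarrow> 'a set" where
  "monic \<equiv> monic_terms R J y"

abbreviation extended :: "'a set" where
  "extended \<equiv> J <+> PIdl y"

lemma PIdl_y_ideal: "ideal (PIdl y) R"
  by (rule cgenideal_ideal[OF y_closed])

lemma extended_ideal: "ideal extended R"
  by (rule add_ideals[OF J_ideal PIdl_y_ideal])

lemma extended_pow_ideal: "ideal (ideal_pow R extended n) R"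
  by (rule ideal_pow_ideal[OF extended_ideal])

lemma J_subset_extended: "J \<subseteq> extended"
  by (rule subset_set_add[OF J_ideal PIdl_y_ideal])

lemma y_in_extended: "y \<in> extended"
  using subset_set_add[OF J_ideal PIdl_y_ideal] cgenideal_self[OF y_closed] by blast

lemma lower_ideal: "ideal (lower n) R"
  unfolding lower_terms_def by (rule ideal_prod_is_ideal[OF J_ideal extended_pow_ideal])

lemma lower_closed: "a \<in> lower n \<Longrightarrow> a \<in> carrier R"
  by (rule ideal.Icarr[OF lower_ideal])

lemma lower_0: "lower 0 = J"
  by (simp add: lower_terms_def ideal_prod_one J_ideal)

lemma lower_subset_extended_pow: "lower n \<subseteq> ideal_pow R extended (Suc n)"
  by (simp add: lower_terms_def ideal_prod_mono[OF J_subset_extended order_refl])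

lemma extended_pow_mult_lower:
  assumes "a \<in> ideal_pow R extended k" "b \<in> lower n"
  shows "a \<otimes> b \<in> lower (k + n)"
proof -
  have "a \<otimes> b \<in> ideal_pow R extended k \<cdot> (J \<cdot> ideal_pow R extended n)"
    using assms unfolding lower_terms_def by (rule ideal_prod.prod)
  then show ?thesis
    by (simp add: lower_terms_def ideal_pow_add[OF extended_ideal]
        ideal_prod_left_commute[OF extended_pow_ideal J_ideal extended_pow_ideal])
qed

lemma monicI: "v \<in> lower n \<Longrightarrow> y [^] Suc n \<oplus> v \<in> monic n"
  by (auto simp: monic_terms_def)

lemma monicE:
  assumes "\<theta> \<in> monic n"
  obtains v where "v \<in> lower n" "v \<in> carrier R" "\<theta> = y [^] Suc n \<oplus> v"
  using assms lower_closed by (auto simp: monic_terms_def)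

lemma monic_subset_extended_pow: "monic n \<subseteq> ideal_pow R extended (Suc n)"
  using ideal_add_closed[OF extended_pow_ideal pow_in_ideal_pow[OF extended_ideal y_in_extended]]
    lower_subset_extended_pow by (blast elim: monicE)

lemma monic_closed: "\<theta> \<in> monic n \<Longrightarrow> \<theta> \<in> carrier R"
  using y_closed by (auto elim: monicE)

lemma y_in_monic_0: "y \<in> monic 0"
  using monicI[OF ideal_zero_closed[OF lower_ideal], of 0] y_closed by simp

lemma monic_minus_lower:
  assumes "\<theta> \<in> monic n" "v \<in> lower n"
  shows "\<theta> \<ominus> v \<in> monic n"
proof -
  obtain u where u: "u \<in> lower n" "u \<in> carrier R" "\<theta> = y [^] Suc n \<oplus> u"
    by (rule monicE[OF assms(1)])
  have "\<theta> \<ominus> v = y [^] Suc n \<oplus> (u \<ominus> v)"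
    unfolding u(3) minus_eq using u(2) y_closed lower_closed[OF assms(2)] by (simp add: a_assoc)
  then show ?thesis using monicI[OF ideal_minus_closed[OF lower_ideal u(1) assms(2)]] by simp
qed

lemma monic_mult_monic:
  assumes "\<theta> \<in> monic m" "\<eta> \<in> monic n"
  shows "\<theta> \<otimes> \<eta> \<in> monic (Suc (m + n))"
proof -
  obtain u where u: "u \<in> lower m" "u \<in> carrier R" "\<theta> = y [^] Suc m \<oplus> u"
    by (rule monicE[OF assms(1)])
  obtain v where v: "v \<in> lower n" "v \<in> carrier R" "\<eta> = y [^] Suc n \<oplus> v"
    by (rule monicE[OF assms(2)])
  define a b where "a = y [^] Suc m" and "b = y [^] Suc n"
  then have powers: "a \<in> carrier R" "b \<in> carrier R" "y [^] Suc (Suc (m + n)) = a \<otimes> b"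
    using y_closed nat_pow_mult[of y "Suc m" "Suc n"] by auto
  have product: "\<theta> \<otimes> \<eta> = y [^] Suc (Suc (m + n)) \<oplus> (\<theta> \<otimes> v \<oplus> b \<otimes> u)"
    unfolding u(3) v(3) powers(3) a_def[symmetric] b_def[symmetric]
    using u(2) v(2) powers(1,2) by algebra
  have "\<theta> \<otimes> v \<in> lower (Suc (m + n))"
    using extended_pow_mult_lower[OF _ v(1), of \<theta> "Suc m"] monic_subset_extended_pow assms(1) by auto
  moreover have "b \<otimes> u \<in> lower (Suc (m + n))"
    using extended_pow_mult_lower[OF pow_in_ideal_pow[OF extended_ideal y_in_extended] u(1), of "Suc n"]
    by (simp add: b_def add.commute)
  ultimately show ?thesis
    unfolding product by (intro monicI ideal_add_closed[OF lower_ideal])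
qed

lemma lower_prod_Idl_ideal: "B \<subseteq> carrier R \<Longrightarrow> ideal (lower n \<cdot> (Idl B)) R"
  by (rule ideal_prod_is_ideal[OF lower_ideal genideal_ideal])

lemma extended_pow_mult_lower_prod:
  assumes "B \<subseteq> carrier R" "a \<in> ideal_pow R extended k" "h \<in> lower n \<cdot> (Idl B)"
  shows "a \<otimes> h \<in> lower (k + n) \<cdot> (Idl B)"
  using assms(1) ideal.Icarr[OF extended_pow_ideal assms(2)] extended_pow_mult_lower[OF assms(2)]
  by (intro mult_ideal_prod[OF lower_ideal genideal_ideal _ _ assms(3)]) auto

lemma lower_prod_Idl_insertE:
  assumes "B \<subseteq> carrier R" "b \<in> carrier R" "h \<in> lower n \<cdot> (Idl (insert b B))"
  obtains u g where "u \<in> lower n" "g \<in> lower n \<cdot> (Idl B)" "h = u \<otimes> b \<oplus> g"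
proof -
  have "lower n \<cdot> (Idl (insert b B)) = (lower n \<cdot> (Idl B)) <+> (\<lambda>u. u \<otimes> b) ` lower n"
    using assms(1,2) Idl_insert[OF assms(1,2)]
    by (simp add: ideal_prod_distr lower_ideal genideal_ideal cgenideal_ideal ideal_prod_cgenideal)
  then obtain g u where g: "g \<in> lower n \<cdot> (Idl B)" and u: "u \<in> lower n" and h: "h = g \<oplus> u \<otimes> b"
    using assms(3) unfolding set_add_def' by auto
  moreover have "g \<in> carrier R" by (rule ideal.Icarr[OF lower_prod_Idl_ideal[OF assms(1)] g])
  ultimately show thesis
    using that[of u g] assms(2) lower_closed by (simp add: a_comm)
qed

text \<open>A relation for \<open>k\<close> with a monic coefficient eliminates \<open>k\<close> from all other relations, as in
  Gaussian elimination; the coefficients stay monic because only lower terms are moved around.\<close>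

lemma monic_relation_isolate:
  assumes B: "B \<subseteq> carrier R" "k \<in> carrier R"
    and \<theta>: "\<theta> \<in> monic n" "\<theta> \<otimes> k \<in> lower n \<cdot> (Idl (insert k B))"
  obtains \<eta> where "\<eta> \<in> monic n" "\<eta> \<otimes> k \<in> lower n \<cdot> (Idl B)"
proof -
  obtain u g where u: "u \<in> lower n" and g: "g \<in> lower n \<cdot> (Idl B)" and eq: "\<theta> \<otimes> k = u \<otimes> k \<oplus> g"
    by (rule lower_prod_Idl_insertE[OF B \<theta>(2)])
  have carrier: "\<theta> \<in> carrier R" "u \<in> carrier R" "g \<in> carrier R"
    using monic_closed[OF \<theta>(1)] lower_closed[OF u]
      ideal.Icarr[OF lower_prod_Idl_ideal[OF B(1)] g] by auto
  have "(\<theta> \<ominus> u) \<otimes> k = \<theta> \<otimes> k \<ominus> u \<otimes> k" using carrier B(2) by algebra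
  also have "\<dots> = g" unfolding eq using carrier B(2) by algebra
  finally show thesis using that[of "\<theta> \<ominus> u"] monic_minus_lower[OF \<theta>(1) u] g by simp
qed

lemma monic_relation_eliminate:
  assumes B: "B \<subseteq> carrier R" "k \<in> carrier R" "b \<in> carrier R"
    and \<eta>: "\<eta> \<in> monic n" "\<eta> \<otimes> k \<in> lower n \<cdot> (Idl B)"
    and \<theta>: "\<theta> \<in> monic n" "\<theta> \<otimes> b \<in> lower n \<cdot> (Idl (insert k B))"
  shows "(\<eta> \<otimes> \<theta>) \<otimes> b \<in> lower (Suc (n + n)) \<cdot> (Idl B)"
proof -
  obtain u g where u: "u \<in> lower n" and g: "g \<in> lower n \<cdot> (Idl B)" and eq: "\<theta> \<otimes> b = u \<otimes> k \<oplus> g"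
    by (rule lower_prod_Idl_insertE[OF B(1,2) \<theta>(2)])
  have carrier: "\<theta> \<in> carrier R" "\<eta> \<in> carrier R" "u \<in> carrier R" "g \<in> carrier R"
    using monic_closed[OF \<theta>(1)] monic_closed[OF \<eta>(1)] lower_closed[OF u]
      ideal.Icarr[OF lower_prod_Idl_ideal[OF B(1)] g] by auto
  have "(\<eta> \<otimes> \<theta>) \<otimes> b = \<eta> \<otimes> (u \<otimes> k \<oplus> g)" using carrier B(3) by (simp add: m_assoc flip: eq)
  also have "\<dots> = u \<otimes> (\<eta> \<otimes> k) \<oplus> \<eta> \<otimes> g" using carrier B(2) by algebra
  also have "\<dots> \<in> lower (Suc (n + n)) \<cdot> (Idl B)"
  proof (rule ideal_add_closed[OF lower_prod_Idl_ideal[OF B(1)]])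
    show "u \<otimes> (\<eta> \<otimes> k) \<in> lower (Suc (n + n)) \<cdot> (Idl B)"
      using extended_pow_mult_lower_prod[OF B(1) _ \<eta>(2), of u "Suc n"]
        u lower_subset_extended_pow by auto
    show "\<eta> \<otimes> g \<in> lower (Suc (n + n)) \<cdot> (Idl B)"
      using extended_pow_mult_lower_prod[OF B(1) _ g, of \<eta> "Suc n"]
        \<eta>(1) monic_subset_extended_pow by auto
  qed
  finally show ?thesis .
qed

lemma exists_monic_annihilator:
  assumes "finite B" "B \<subseteq> carrier R"
    and "\<And>b. b \<in> B \<Longrightarrow> \<exists>\<theta>\<in>monic n. \<theta> \<otimes> b \<in> lower n \<cdot> (Idl B)"
  shows "\<exists>m. \<exists>\<theta>\<in>monic m. \<forall>b\<in>B. \<theta> \<otimes> b = \<zero>"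
  using assms
proof (induction B arbitrary: n rule: finite_induct)
  case empty
  then show ?case using y_in_monic_0 by auto
next
  case (insert k B)
  then have k: "k \<in> carrier R" and B: "B \<subseteq> carrier R" by auto
  obtain \<eta> where \<eta>: "\<eta> \<in> monic n" "\<eta> \<otimes> k \<in> lower n \<cdot> (Idl B)"
    using insert.prems(2)[of k] monic_relation_isolate[OF B k] by blast
  have "\<exists>\<theta>\<in>monic (Suc (n + n)). \<theta> \<otimes> b \<in> lower (Suc (n + n)) \<cdot> (Idl B)" if b: "b \<in> B" for b
  proof -
    obtain \<theta> where \<theta>: "\<theta> \<in> monic n" "\<theta> \<otimes> b \<in> lower n \<cdot> (Idl (insert k B))"
      using insert.prems(2)[of b] b by blast
    then have "(\<eta> \<otimes> \<theta>) \<otimes> b \<in> lower (Suc (n + n)) \<cdot> (Idl B)"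
      using b B by (intro monic_relation_eliminate[OF B k _ \<eta>]) auto
    then show ?thesis using monic_mult_monic[OF \<eta>(1) \<theta>(1)] by blast
  qed
  then obtain m \<theta> where \<theta>: "\<theta> \<in> monic m" "\<And>b. b \<in> B \<Longrightarrow> \<theta> \<otimes> b = \<zero>"
    using insert.IH[OF B] by blast
  have carrier: "\<theta> \<in> carrier R" "\<eta> \<in> carrier R" using monic_closed \<theta>(1) \<eta>(1) by auto
  have "\<eta> \<otimes> k \<in> Idl B"
    using \<eta>(2) ideal_prod_inter[OF lower_ideal genideal_ideal[OF B]] by blast
  then have "\<theta> \<otimes> (\<eta> \<otimes> k) = \<zero>"
    using mult_Idl_subset[OF B zeroideal carrier(1)] \<theta>(2) by blast
  then have "(\<theta> \<otimes> \<eta>) \<otimes> k = \<zero>" using carrier k by (simp add: m_assoc)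
  moreover have "(\<theta> \<otimes> \<eta>) \<otimes> b = \<zero>" if "b \<in> B" for b
    using carrier B that \<theta>(2)[OF that] by (metis m_assoc m_comm r_null subsetD)
  ultimately show ?case using monic_mult_monic[OF \<theta>(1) \<eta>(1)] by blast
qed

lemma J_prod_extended_pow_split:
  assumes "ideal P R"
  shows "J \<cdot> (P <+> (PIdl y) \<cdot> ideal_pow R extended n) = (J \<cdot> P) <+> (PIdl y) \<cdot> lower n"
  using ideal_prod_distr(1)[OF J_ideal assms ideal_prod_is_ideal[OF PIdl_y_ideal extended_pow_ideal]]
  by (simp add: lower_terms_def ideal_prod_left_commute[OF J_ideal PIdl_y_ideal extended_pow_ideal])

lemma extended_pow_Suc_subset:
  "ideal_pow R extended (Suc n) \<subseteq> ideal_pow R J (Suc n) <+> (PIdl y) \<cdot> ideal_pow R extended n"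
proof (induction n)
  case 0
  then show ?case by (simp add: ideal_prod_one extended_ideal J_ideal PIdl_y_ideal)
next
  case (Suc n)
  let ?E = "ideal_pow R extended" and ?P = "ideal_pow R J"
  let ?K = "?P (Suc (Suc n)) <+> (PIdl y) \<cdot> ?E (Suc n)"
  have P_ideal: "ideal (?P m) R" for m by (rule ideal_pow_ideal[OF J_ideal])
  have yE_ideal: "ideal ((PIdl y) \<cdot> ?E m) R" for m
    by (rule ideal_prod_is_ideal[OF PIdl_y_ideal extended_pow_ideal])
  have "?E (Suc (Suc n)) = (J \<cdot> ?E (Suc n)) <+> (PIdl y) \<cdot> ?E (Suc n)"
    using ideal_prod_distr(2)[OF extended_pow_ideal[of "Suc n"] J_ideal PIdl_y_ideal] by simp
  also have "\<dots> \<subseteq> ?K"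
  proof (rule set_add_subset_ideal)
    show "ideal ?K R" by (rule add_ideals[OF P_ideal yE_ideal])
    have "J \<cdot> ?E (Suc n) \<subseteq> J \<cdot> (?P (Suc n) <+> (PIdl y) \<cdot> ?E n)"
      by (rule ideal_prod_mono[OF order_refl Suc])
    also have "\<dots> = ?P (Suc (Suc n)) <+> (PIdl y) \<cdot> lower n"
      using J_prod_extended_pow_split[OF P_ideal[of "Suc n"]] by (simp only: ideal_pow.simps)
    also have "\<dots> \<subseteq> ?K"
      by (intro set_add_mono order_refl ideal_prod_mono lower_subset_extended_pow)
    finally show "J \<cdot> ?E (Suc n) \<subseteq> ?K" .
    show "(PIdl y) \<cdot> ?E (Suc n) \<subseteq> ?K" by (rule subset_set_add(2)[OF P_ideal yE_ideal])
  qed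
  finally show ?case .
qed

lemma lower_SucE:
  assumes "v \<in> lower (Suc n)"
  obtains w c where "w \<in> lower n" "c \<in> ideal_pow R J (Suc (Suc n))" "v = y \<otimes> w \<oplus> c"
proof -
  let ?P = "ideal_pow R J"
  have P_ideal: "ideal (?P m) R" for m by (rule ideal_pow_ideal[OF J_ideal])
  have "lower (Suc n) \<subseteq> J \<cdot> (?P (Suc n) <+> (PIdl y) \<cdot> ideal_pow R extended n)"
    unfolding lower_terms_def by (rule ideal_prod_mono[OF order_refl extended_pow_Suc_subset])
  also have "\<dots> = ?P (Suc (Suc n)) <+> lower n \<cdot> (PIdl y)"
    using J_prod_extended_pow_split[OF P_ideal[of "Suc n"]]
      ideal_prod_commute[OF PIdl_y_ideal lower_ideal]
    by (simp only: ideal_pow.simps)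
  also have "lower n \<cdot> (PIdl y) = (\<lambda>w. w \<otimes> y) ` lower n"
    by (rule ideal_prod_cgenideal[OF lower_ideal y_closed])
  finally obtain c w where c: "c \<in> ?P (Suc (Suc n))" and w: "w \<in> lower n" and v: "v = c \<oplus> w \<otimes> y"
    using assms unfolding set_add_def' by auto
  moreover have "c \<in> carrier R" by (rule ideal.Icarr[OF P_ideal c])
  ultimately show thesis
    using that[of w c] y_closed lower_closed[OF w] by (simp add: a_comm m_comm)
qed

lemma finsum_powers_Suc:
  fixes n :: nat
  assumes c: "\<And>i. i \<in> {1..n} \<Longrightarrow> c i \<in> carrier R" and e: "e \<in> carrier R"
  shows "y \<otimes> finsum R (\<lambda>i. c i \<otimes> y [^] (n - i)) {1..n} \<oplus> e =
    finsum R (\<lambda>i. (c(Suc n := e)) i \<otimes> y [^] (Suc n - i)) {1..Suc n}"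
proof -
  let ?f = "\<lambda>i. (c(Suc n := e)) i \<otimes> y [^] (Suc n - i)"
  have f_closed: "?f \<in> {1..n} \<rightarrow> carrier R" using c y_closed by auto
  have "y \<otimes> finsum R (\<lambda>i. c i \<otimes> y [^] (n - i)) {1..n} = finsum R (\<lambda>i. y \<otimes> (c i \<otimes> y [^] (n - i))) {1..n}"
    by (rule finsum_rdistr) (use c y_closed in auto)
  also have "\<dots> = finsum R ?f {1..n}"
  proof (rule finsum_cong'[OF refl f_closed])
    fix i assume i: "i \<in> {1..n}"
    then have "Suc n - i = Suc (n - i)" by auto
    then show "y \<otimes> (c i \<otimes> y [^] (n - i)) = ?f i"
      using i c[OF i] y_closed by (simp add: m_lcomm m_comm)
  qed
  finally have "y \<otimes> finsum R (\<lambda>i. c i \<otimes> y [^] (n - i)) {1..n} \<oplus> e = ?f (Suc n) \<oplus> finsum R ?f {1..n}"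
    using e finsum_closed[OF f_closed] by (simp add: a_comm)
  also have "\<dots> = finsum R ?f (insert (Suc n) {1..n})"
    by (rule finsum_insert[symmetric]) (use f_closed e in auto)
  also have "insert (Suc n) {1..n} = {1..Suc n}" by auto
  finally show ?thesis .
qed

lemma lower_expansion:
  "v \<in> lower n \<Longrightarrow> \<exists>c. (\<forall>i\<in>{1..Suc n}. c i \<in> ideal_pow R J i) \<and>
     v = finsum R (\<lambda>i. c i \<otimes> y [^] (Suc n - i)) {1..Suc n}"
proof (induction n arbitrary: v)
  case 0
  then have "v \<in> J" "v \<in> carrier R" using lower_0 ideal.Icarr[OF J_ideal] by auto
  then show ?case
    using J_ideal by (intro exI[of _ "\<lambda>_. v"]) (auto simp: ideal_prod_one)
next
  case (Suc n)
  obtain w e where w: "w \<in> lower n" and e: "e \<in> ideal_pow R J (Suc (Suc n))" and v: "v = y \<otimes> w \<oplus> e"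
    by (rule lower_SucE[OF Suc.prems])
  obtain c where c: "\<forall>i\<in>{1..Suc n}. c i \<in> ideal_pow R J i"
    "w = finsum R (\<lambda>i. c i \<otimes> y [^] (Suc n - i)) {1..Suc n}"
    using Suc.IH[OF w] by blast
  let ?c = "c(Suc (Suc n) := e)"
  have "\<forall>i\<in>{1..Suc (Suc n)}. ?c i \<in> ideal_pow R J i"
    using c(1) e by (auto simp: le_Suc_eq)
  moreover have "v = finsum R (\<lambda>i. ?c i \<otimes> y [^] (Suc (Suc n) - i)) {1..Suc (Suc n)}"
    unfolding v c(2) using c(1) e ideal.Icarr[OF ideal_pow_ideal[OF J_ideal]]
    by (intro finsum_powers_Suc) blast+
  ultimately show ?case by blast
qed

lemma int_closure_of_monic_zero:
  assumes "\<zero> \<in> monic n"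
  shows "y \<in> int_closure R J"
proof -
  obtain v where v: "v \<in> lower n" "y [^] Suc n \<oplus> v = \<zero>" using assms by (metis monicE)
  then obtain c where c: "\<forall>i\<in>{1..Suc n}. c i \<in> ideal_pow R J i"
    "v = finsum R (\<lambda>i. c i \<otimes> y [^] (Suc n - i)) {1..Suc n}"
    using lower_expansion by blast
  show ?thesis
    unfolding int_closure_def
    by (intro CollectI conjI exI[of _ "Suc n"] exI[of _ c] y_closed c(1) v(2)[unfolded c(2)]) simp
qed

end

theorem (in noetherian_domain) determinant_trick:
  assumes J: "ideal J R" and H: "ideal H R" "H \<noteq> {\<zero>}"
    and y: "y \<in> carrier R" "\<And>h. h \<in> H \<Longrightarrow> y \<otimes> h \<in> J \<cdot> H"
  shows "y \<in> int_closure R J"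
proof -
  interpret ideal_and_element R J y
    by (intro ideal_and_element.intro ideal_and_element_axioms.intro cring_axioms J y(1))
  obtain B where B: "B \<subseteq> carrier R" "finite B" "H = Idl B" using finetely_gen[OF H(1)] by blast
  have "\<exists>\<theta>\<in>monic 0. \<theta> \<otimes> b \<in> lower 0 \<cdot> (Idl B)" if "b \<in> B" for b
    using y(2)[of b] genideal_self[OF B(1)] that B(3) y_in_monic_0 lower_0 by auto
  then obtain m \<theta> where \<theta>: "\<theta> \<in> monic m" "\<forall>b\<in>B. \<theta> \<otimes> b = \<zero>"
    using exists_monic_annihilator[OF B(2,1)] by blast
  have "\<not> B \<subseteq> {\<zero>}"
    using H(2) genideal_minimal[OF zeroideal, of B] ideal_zero_closed[OF H(1)] unfolding B(3) by blast
  then obtain b where "b \<in> B" "b \<noteq> \<zero>" by blast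
  then have "\<theta> = \<zero>" using \<theta> integral[of \<theta> b] monic_closed B(1) by blast
  then show ?thesis using int_closure_of_monic_zero \<theta>(1) by simp
qed

section \<open>Monomial ideals\<close>

definition single_exponent :: "nat \<Rightarrow> nat \<Rightarrow> nat \<Rightarrow> nat" where
  "single_exponent i k = (\<lambda>_. 0)(i := k)"

lemma single_exponent_apply [simp]: "single_exponent i k j = (if j = i then k else 0)"
  by (simp add: single_exponent_def)

abbreviation irreducible_exponents :: "nat set \<Rightarrow> (nat \<Rightarrow> nat) \<Rightarrow> (nat \<Rightarrow> nat) set" where
  "irreducible_exponents S b \<equiv> (\<lambda>i. single_exponent i (Suc (b i))) ` S"

locale monomial_system = cring R for R (structure) +
  fixes x :: "nat \<Rightarrow> 'a" and d :: nat
  assumes x_closed: "i < d \<Longrightarrow> x i \<in> carrier R"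
    and primeideal_Idl_x: "S \<subseteq> {..<d} \<Longrightarrow> primeideal (Idl (x ` S)) R"
    and x_notin_Idl_x: "S \<subseteq> {..<d} \<Longrightarrow> i < d \<Longrightarrow> i \<notin> S \<Longrightarrow> x i \<notin> Idl (x ` S)"
begin

abbreviation mon :: "(nat \<Rightarrow> nat) \<Rightarrow> 'a" where
  "mon \<equiv> monomial R x d"

abbreviation mon_ideal :: "(nat \<Rightarrow> nat) set \<Rightarrow> 'a set" where
  "mon_ideal G \<equiv> Idl (mon ` G)"

abbreviation param_ideal :: "nat set \<Rightarrow> 'a set" where
  "param_ideal S \<equiv> Idl (x ` S)"

lemma mon_closed [simp]: "mon e \<in> carrier R"
  unfolding monomial_def by (rule finprod_closed) (auto simp: x_closed)

lemma mon_image_closed [simp]: "mon ` G \<subseteq> carrier R"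
  by auto

lemma mon_cong: "(\<And>i. i < d \<Longrightarrow> e i = f i) \<Longrightarrow> mon e = mon f"
  unfolding monomial_def by (rule finprod_cong') (auto simp: x_closed)

lemma mon_add: "mon (e + f) = mon e \<otimes> mon f"
proof -
  have "mon e \<otimes> mon f = finprod R (\<lambda>i. x i [^] e i \<otimes> x i [^] f i) {..<d}"
    unfolding monomial_def by (rule finprod_multf[symmetric]) (auto simp: x_closed)
  also have "\<dots> = mon (e + f)"
    unfolding monomial_def by (rule finprod_cong') (auto simp: x_closed nat_pow_mult)
  finally show ?thesis ..
qed

lemma mon_zero: "(\<And>i. i < d \<Longrightarrow> e i = 0) \<Longrightarrow> mon e = \<one>"
  unfolding monomial_def by (rule finprod_one_eqI) auto

lemma mon_single_exponent:
  assumes "i < d"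
  shows "mon (single_exponent i k) = x i [^] k"
proof -
  have "mon (single_exponent i k) = finprod R (\<lambda>j. if i = j then x j [^] k else \<one>) {..<d}"
    unfolding monomial_def by (rule finprod_cong') (auto simp: x_closed)
  also have "\<dots> = x i [^] k"
    using assms by (subst finprod_singleton) (auto simp: x_closed)
  finally show ?thesis .
qed

lemma mon_ideal_ideal [simp]: "ideal (mon_ideal G) R"
  by (simp add: genideal_ideal)

lemma mon_ideal_carrier: "y \<in> mon_ideal G \<Longrightarrow> y \<in> carrier R"
  by (rule Idl_carrier) auto

lemma mon_in_mon_ideal:
  assumes "g \<in> G" "\<And>i. i < d \<Longrightarrow> g i \<le> e i"
  shows "mon e \<in> mon_ideal G"
proof -
  have "mon e = mon ((e - g) + g)" by (rule mon_cong) (use assms(2) in simp)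
  moreover have "mon g \<in> mon_ideal G" using assms(1) genideal_self[of "mon ` G"] by auto
  ultimately show ?thesis by (simp add: mon_add ideal.I_l_closed)
qed

lemma mon_ideal_subset:
  assumes "\<And>g. g \<in> G \<Longrightarrow> \<exists>h\<in>H. \<forall>i<d. h i \<le> g i"
  shows "mon_ideal G \<subseteq> mon_ideal H"
  by (rule genideal_minimal) (use assms mon_in_mon_ideal in \<open>fastforce+\<close>)

lemma mon_ideal_mono: "G \<subseteq> H \<Longrightarrow> mon_ideal G \<subseteq> mon_ideal H"
  by (rule Idl_mono) auto

lemma mon_ideal_eq_carrier:
  assumes "g \<in> G" "\<And>i. i < d \<Longrightarrow> g i = 0"
  shows "mon_ideal G = carrier R"
  using mon_in_mon_ideal[OF assms(1), of "\<lambda>_. 0"] mon_zero[of "\<lambda>_. 0"] assms(2)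
  by (intro ideal.one_imp_carrier) auto

lemma mon_ideal_finite_subset:
  assumes "y \<in> mon_ideal G"
  obtains H where "finite H" "H \<subseteq> G" "y \<in> mon_ideal H"
  using Idl_finite_subset[OF mon_image_closed assms] finite_subset_image by metis

lemma mon_ideal_insertE:
  assumes "z \<in> mon_ideal (insert e G)"
  obtains k c where "k \<in> mon_ideal G" "c \<in> carrier R" "z = k \<oplus> c \<otimes> mon e"
  using Idl_insertE[of "mon ` G" "mon e" z] assms by auto

lemma mon_ideal_prod: "(mon_ideal G) \<cdot> (mon_ideal H) = mon_ideal (G + H)"
proof -
  have "mon ` G <#> mon ` H = mon ` (G + H)"
    unfolding set_mult_def set_plus_def by (force simp: mon_add)
  then show ?thesis by (simp add: Idl_prod_Idl)
qed

lemma mon_mult_mon_ideal: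
  assumes "\<And>g. g \<in> G \<Longrightarrow> \<exists>h\<in>H. \<forall>i<d. h i \<le> f i + g i" "u \<in> mon_ideal G"
  shows "mon f \<otimes> u \<in> mon_ideal H"
proof (rule mult_Idl_subset[OF mon_image_closed _ _ _ assms(2)])
  fix m assume "m \<in> mon ` G"
  then obtain g h where "m = mon g" "h \<in> H" "\<forall>i<d. h i \<le> f i + g i" using assms(1) by blast
  then show "mon f \<otimes> m \<in> mon_ideal H"
    using mon_in_mon_ideal[of h H "f + g"] by (simp add: mon_add)
qed auto

lemma param_ideal_ideal: "S \<subseteq> {..<d} \<Longrightarrow> ideal (param_ideal S) R"
  using primeideal_Idl_x by (simp add: primeideal.axioms(1))

lemma one_notin_param_ideal: "S \<subseteq> {..<d} \<Longrightarrow> \<one> \<notin> param_ideal S"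
  using primeideal.I_notcarr[OF primeideal_Idl_x] ideal.one_imp_carrier[OF param_ideal_ideal] by blast

lemma param_ideal_mono: "S \<subseteq> T \<Longrightarrow> T \<subseteq> {..<d} \<Longrightarrow> param_ideal S \<subseteq> param_ideal T"
  using x_closed by (intro Idl_mono image_mono) auto

lemma mon_in_param_ideal:
  assumes "S \<subseteq> {..<d}" "i \<in> S" "0 < e i"
  shows "mon e \<in> param_ideal S"
proof -
  have "i < d" using assms by blast
  have "mon e = mon (e(i := e i - 1) + single_exponent i 1)" by (rule mon_cong) (use assms in auto)
  moreover have "x i \<in> param_ideal S" using assms x_closed genideal_self[of "x ` S"] by blast
  ultimately show ?thesis
    using x_closed \<open>i < d\<close> mon_single_exponent[of i 1]
    by (simp add: mon_add ideal.I_l_closed[OF param_ideal_ideal[OF assms(1)]])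
qed

definition mon_deg :: "(nat \<Rightarrow> nat) \<Rightarrow> nat" where
  "mon_deg g = (\<Sum>i<d. g i)"

lemma mon_deg_eq_0_iff: "mon_deg g = 0 \<longleftrightarrow> (\<forall>i<d. g i = 0)"
  by (auto simp: mon_deg_def)

lemma mon_deg_eq_1E:
  assumes "mon_deg g = 1"
  obtains s where "s < d" "\<And>i. i < d \<Longrightarrow> g i = single_exponent s 1 i"
proof -
  have "\<exists>s\<in>{..<d}. g s = 1 \<and> (\<forall>b\<in>{..<d}. s \<noteq> b \<longrightarrow> g b = 0)"
    using assms unfolding mon_deg_def by (subst (asm) sum_eq_1_iff) auto
  then obtain s where "s < d" "g s = 1" "\<And>b. b < d \<Longrightarrow> b \<noteq> s \<Longrightarrow> g b = 0" by auto
  then show thesis using that[of s] by auto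
qed

lemma mon_ideal_linear:
  assumes "\<And>g. g \<in> G \<Longrightarrow> mon_deg g = 1"
  shows "mon_ideal G = param_ideal {i. i < d \<and> (\<exists>g\<in>G. g i \<noteq> 0)}"
proof -
  have linear: "\<exists>s<d. mon g = x s \<and> (\<forall>i<d. g i \<noteq> 0 \<longleftrightarrow> i = s)" if "g \<in> G" for g
  proof -
    have "mon_deg g = 1" by (rule assms[OF that])
    then obtain s where s: "s < d" "\<And>i. i < d \<Longrightarrow> g i = single_exponent s 1 i"
      using mon_deg_eq_1E by metis
    have "mon g = mon (single_exponent s 1)" by (rule mon_cong) (rule s(2))
    then have "mon g = x s" using mon_single_exponent[OF s(1), of 1] x_closed[OF s(1)] by simp
    then show ?thesis using s by (intro exI[of _ s]) auto
  qed
  have "mon ` G = x ` {i. i < d \<and> (\<exists>g\<in>G. g i \<noteq> 0)}"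
  proof (intro equalityI subsetI)
    fix m assume "m \<in> mon ` G"
    then show "m \<in> x ` {i. i < d \<and> (\<exists>g\<in>G. g i \<noteq> 0)}" using linear by fast
  next
    fix m assume "m \<in> x ` {i. i < d \<and> (\<exists>g\<in>G. g i \<noteq> 0)}"
    then obtain i g where "i < d" "g \<in> G" "g i \<noteq> 0" "m = x i" by blast
    then show "m \<in> mon ` G" using linear[of g] by (metis imageI)
  qed
  then show ?thesis by simp
qed

subsection \<open>Colon ideals\<close>

definition lower_exponent :: "nat \<Rightarrow> (nat \<Rightarrow> nat) \<Rightarrow> nat \<Rightarrow> nat" where
  "lower_exponent i g = g(i := g i - 1)"

lemma mon_lower_exponent:
  assumes "i < d" "g i \<noteq> 0"
  shows "mon g = x i \<otimes> mon (lower_exponent i g)"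
proof -
  have "mon g = mon (single_exponent i 1 + lower_exponent i g)"
    by (rule mon_cong) (use assms in \<open>auto simp: lower_exponent_def\<close>)
  then show ?thesis using assms(1) x_closed mon_single_exponent[of i 1] by (simp add: mon_add)
qed

lemma x_mult_mon_ideal_lower:
  assumes "i < d" "v \<in> mon_ideal (lower_exponent i ` G)"
  shows "x i \<otimes> v \<in> mon_ideal G"
proof -
  have "mon (single_exponent i 1) \<otimes> v \<in> mon_ideal G"
  proof (rule mon_mult_mon_ideal[OF _ assms(2)])
    fix g assume "g \<in> lower_exponent i ` G"
    then obtain h where "h \<in> G" "g = lower_exponent i h" by blast
    then show "\<exists>h\<in>G. \<forall>j<d. h j \<le> single_exponent i 1 j + g j"
      by (intro bexI[of _ h]) (auto simp: lower_exponent_def)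
  qed
  then show ?thesis using mon_single_exponent[OF assms(1), of 1] x_closed[OF assms(1)] by simp
qed

lemma mon_ideal_split:
  assumes j: "j < d" and z: "z \<in> mon_ideal G"
  obtains a b where "a \<in> mon_ideal {g \<in> G. g j = 0}" "b \<in> mon_ideal (lower_exponent j ` G)"
    "z = a \<oplus> x j \<otimes> b"
proof -
  let ?A = "mon_ideal {g \<in> G. g j = 0}" and ?B = "mon_ideal (lower_exponent j ` G)"
  have PIdl: "ideal (PIdl (x j)) R" by (rule cgenideal_ideal[OF x_closed[OF j]])
  note subsets = subset_set_add[OF mon_ideal_ideal ideal_prod_is_ideal[OF mon_ideal_ideal PIdl]]
  have "mon g \<in> ?A <+> ?B \<cdot> (PIdl (x j))" if "g \<in> G" for g
  proof (cases "g j = 0")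
    case True
    then have "mon g \<in> ?A" using that by (intro mon_in_mon_ideal[of g]) auto
    then show ?thesis using subsets(1) by blast
  next
    case False
    have "mon (lower_exponent j g) \<in> ?B"
      using that by (intro mon_in_mon_ideal[of "lower_exponent j g"]) auto
    then have "mon (lower_exponent j g) \<otimes> x j \<in> ?B \<cdot> (PIdl (x j))"
      using cgenideal_self[OF x_closed[OF j]] by (rule ideal_prod.prod)
    then have "mon g \<in> ?B \<cdot> (PIdl (x j))"
      using mon_lower_exponent[of j g, OF j False] x_closed[OF j] by (simp add: m_comm)
    then show ?thesis using subsets(2) by blast
  qed
  then have "mon_ideal G \<subseteq> ?A <+> ?B \<cdot> (PIdl (x j))"
    by (intro genideal_minimal add_ideals ideal_prod_is_ideal mon_ideal_ideal PIdl) auto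
  then obtain a b where "a \<in> ?A" "b \<in> ?B" "z = a \<oplus> b \<otimes> x j"
    using z unfolding ideal_prod_cgenideal[OF mon_ideal_ideal x_closed[OF j]] set_add_def' by auto
  then show thesis
    using that[of a b] mon_ideal_carrier[of b] x_closed[OF j] by (simp add: m_comm)
qed

text \<open>Only the generators free of \<open>x\<^sub>j\<close> matter, which allows an induction on the generating set.\<close>

lemma colon_x_if_nonzerodivisor:
  assumes j: "j < d" and nonzerodivisor: "nonzerodivisor_mod (x j) (mon_ideal {g \<in> G. g j = 0})"
    and u: "u \<in> carrier R" "x j \<otimes> u \<in> mon_ideal G"
  shows "u \<in> mon_ideal (lower_exponent j ` G)"
proof -
  obtain a b where a: "a \<in> mon_ideal {g \<in> G. g j = 0}" and b: "b \<in> mon_ideal (lower_exponent j ` G)"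
    and split: "x j \<otimes> u = a \<oplus> x j \<otimes> b"
    by (rule mon_ideal_split[OF j u(2)])
  note carrier = x_closed[OF j] u(1) mon_ideal_carrier[OF a] mon_ideal_carrier[OF b]
  have "x j \<otimes> (u \<ominus> b) = x j \<otimes> u \<ominus> x j \<otimes> b" using carrier by algebra
  also have "\<dots> = a" unfolding split using carrier by algebra
  finally have "u \<ominus> b \<in> mon_ideal {g \<in> G. g j = 0}"
    using nonzerodivisor a carrier unfolding nonzerodivisor_mod_def by simp
  moreover have "g = lower_exponent j g" if "g j = 0" for g
    using that by (auto simp: lower_exponent_def)
  then have "mon_ideal {g \<in> G. g j = 0} \<subseteq> mon_ideal (lower_exponent j ` G)"
    by (intro mon_ideal_mono) blast
  ultimately have "(u \<ominus> b) \<oplus> b \<in> mon_ideal (lower_exponent j ` G)"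
    using b by (intro ideal_add_closed[OF mon_ideal_ideal]) auto
  moreover have "(u \<ominus> b) \<oplus> b = u" using carrier by algebra
  ultimately show ?thesis by simp
qed

lemma nonzerodivisor_mod_mon_ideal_step:
  assumes j: "j < d" and x_j: "nonzerodivisor_mod (x j) (mon_ideal {g \<in> G. g j = 0})"
    and y_mod_x: "nonzerodivisor_mod y (mon_ideal (insert (single_exponent j 1) {g \<in> G. g j = 0}))"
    and y_lowered: "nonzerodivisor_mod y (mon_ideal (lower_exponent j ` G))"
  shows "nonzerodivisor_mod y (mon_ideal G)"
proof -
  let ?G0 = "{g \<in> G. g j = 0}"
  have y: "y \<in> carrier R" using y_mod_x by (simp add: nonzerodivisor_mod_def)
  have "u \<in> mon_ideal G" if u: "u \<in> carrier R" "y \<otimes> u \<in> mon_ideal G" for u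
  proof -
    have "mon_ideal G \<subseteq> mon_ideal (insert (single_exponent j 1) ?G0)"
    proof (rule mon_ideal_subset)
      show "\<exists>h\<in>insert (single_exponent j 1) ?G0. \<forall>i<d. h i \<le> g i" if "g \<in> G" for g
        using that by (intro bexI[of _ "if g j = 0 then g else single_exponent j 1"]) auto
    qed
    then have "u \<in> mon_ideal (insert (single_exponent j 1) ?G0)"
      using u y_mod_x unfolding nonzerodivisor_mod_def by blast
    then obtain k c where k0: "k \<in> mon_ideal ?G0" and c: "c \<in> carrier R"
      and "u = k \<oplus> c \<otimes> mon (single_exponent j 1)"
      by (rule mon_ideal_insertE)
    then have u_eq: "u = k \<oplus> x j \<otimes> c"
      using mon_single_exponent[OF j, of 1] x_closed[OF j] by (simp add: m_comm)
    note carrier = y c mon_ideal_carrier[OF k0] x_closed[OF j]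
    have k: "k \<in> mon_ideal G" using k0 mon_ideal_mono[of ?G0 G] by blast
    have "y \<otimes> u \<ominus> y \<otimes> k \<in> mon_ideal G"
      using ideal_minus_closed[OF mon_ideal_ideal u(2)] ideal.I_l_closed[OF mon_ideal_ideal k y] .
    moreover have "y \<otimes> u \<ominus> y \<otimes> k = x j \<otimes> (y \<otimes> c)" unfolding u_eq using carrier by algebra
    ultimately have "y \<otimes> c \<in> mon_ideal (lower_exponent j ` G)"
      using colon_x_if_nonzerodivisor[OF j x_j, of "y \<otimes> c"] carrier by simp
    then have "c \<in> mon_ideal (lower_exponent j ` G)"
      using y_lowered c unfolding nonzerodivisor_mod_def by blast
    then show ?thesis
      unfolding u_eq using k x_mult_mon_ideal_lower[OF j]
      by (intro ideal_add_closed[OF mon_ideal_ideal])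
  qed
  then show ?thesis using y by (simp add: nonzerodivisor_mod_def)
qed

lemma sum_mon_deg_insert_single_exponent:
  assumes "finite G" "g \<in> G" "g j \<noteq> 0" "2 \<le> mon_deg g"
  shows "sum mon_deg (insert (single_exponent j 1) {g \<in> G. g j = 0}) < sum mon_deg G"
proof -
  let ?G0 = "{g \<in> G. g j = 0}"
  have "mon_deg (single_exponent j 1) \<le> 1" by (simp add: mon_deg_def)
  then have "sum mon_deg (insert (single_exponent j 1) ?G0) \<le> 1 + sum mon_deg ?G0"
    using assms(1) by (subst sum.insert_if) auto
  also have "\<dots> < sum mon_deg (insert g ?G0)" using assms by simp
  also have "\<dots> \<le> sum mon_deg G" using assms by (intro sum_mono2) auto
  finally show ?thesis .
qed

lemma sum_mon_deg_filter:
  assumes "finite G" "g \<in> G" "j < d" "g j \<noteq> 0"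
  shows "sum mon_deg {g \<in> G. g j = 0} < sum mon_deg G"
proof (rule sum_strict_mono2)
  show "0 < mon_deg g" using assms mon_deg_eq_0_iff[of g] by auto
qed (use assms in auto)

lemma sum_mon_deg_lower_exponent:
  assumes "finite G" "g \<in> G" "j < d" "g j \<noteq> 0"
  shows "sum mon_deg (lower_exponent j ` G) < sum mon_deg G"
proof -
  have "sum mon_deg (lower_exponent j ` G) \<le> (\<Sum>g\<in>G. mon_deg (lower_exponent j g))"
    using sum_image_le[OF assms(1), of mon_deg "lower_exponent j"] by simp
  also have "\<dots> < sum mon_deg G"
  proof (rule sum_strict_mono_ex1[OF assms(1)])
    show "\<forall>g\<in>G. mon_deg (lower_exponent j g) \<le> mon_deg g"
      unfolding mon_deg_def lower_exponent_def by (auto intro: sum_mono)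
    have "mon_deg (lower_exponent j g) < mon_deg g"
      unfolding mon_deg_def lower_exponent_def by (rule sum_strict_mono_ex1) (use assms in auto)
    then show "\<exists>g\<in>G. mon_deg (lower_exponent j g) < mon_deg g" using assms(2) by blast
  qed
  finally show ?thesis .
qed

lemma nonzerodivisor_mod_mon_ideal_linear:
  assumes "T \<subseteq> {..<d}" "\<forall>g\<in>G. \<forall>i<d. g i \<noteq> 0 \<longrightarrow> i \<in> T" "\<And>g. g \<in> G \<Longrightarrow> mon_deg g = 1"
    and y: "y \<in> carrier R" "y \<notin> param_ideal T"
  shows "nonzerodivisor_mod y (mon_ideal G)"
proof -
  let ?S = "{i. i < d \<and> (\<exists>g\<in>G. g i \<noteq> 0)}"
  have "?S \<subseteq> T" using assms(2) by auto
  then have "y \<notin> param_ideal ?S" using param_ideal_mono[OF _ assms(1)] y(2) by auto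
  moreover have prime: "primeideal (param_ideal ?S) R" by (rule primeideal_Idl_x) auto
  moreover have "mon_ideal G = param_ideal ?S" by (rule mon_ideal_linear[OF assms(3)])
  ultimately show ?thesis
    unfolding nonzerodivisor_mod_def using primeideal.I_prime[OF prime y(1)] y(1) by auto
qed

lemma nonzerodivisor_mod_mon_ideal_finite:
  assumes "finite G" "T \<subseteq> {..<d}" "\<forall>g\<in>G. \<forall>i<d. g i \<noteq> 0 \<longrightarrow> i \<in> T"
    and "y \<in> carrier R" "y \<notin> param_ideal T"
  shows "nonzerodivisor_mod y (mon_ideal G)"
  using assms
proof (induction "sum mon_deg G" arbitrary: G T y rule: less_induct)
  case less
  note G_fin = less.prems(1) and T = less.prems(2) and supp = less.prems(3) and y = less.prems(4,5)
  consider (unit) g where "g \<in> G" "mon_deg g = 0" | (linear) "\<And>g. g \<in> G \<Longrightarrow> mon_deg g = 1"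
    | (nonlinear) g where "g \<in> G" "2 \<le> mon_deg g"
    by (metis One_nat_def less_2_cases_iff not_le)
  then show ?case
  proof cases
    case unit
    then show ?thesis
      using mon_ideal_eq_carrier[of g G] y(1) by (auto simp: mon_deg_eq_0_iff nonzerodivisor_mod_def)
  next
    case linear
    then show ?thesis by (rule nonzerodivisor_mod_mon_ideal_linear[OF T supp _ y])
  next
    case nonlinear
    then obtain j where j: "j < d" "g j \<noteq> 0" using mon_deg_eq_0_iff[of g] by auto
    have "j \<in> T" using supp nonlinear(1) j by blast
    let ?G0 = "{g \<in> G. g j = 0}"
    show ?thesis
    proof (rule nonzerodivisor_mod_mon_ideal_step[OF j(1)])
      show "nonzerodivisor_mod (x j) (mon_ideal ?G0)"
      proof (rule less.hyps[OF sum_mon_deg_filter[OF G_fin nonlinear(1) j], of "T - {j}"])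
        show "\<forall>g\<in>?G0. \<forall>i<d. g i \<noteq> 0 \<longrightarrow> i \<in> T - {j}" using supp by auto
        show "x j \<notin> param_ideal (T - {j})" using T j(1) by (intro x_notin_Idl_x) auto
      qed (use G_fin T x_closed j(1) in auto)
      show "nonzerodivisor_mod y (mon_ideal (insert (single_exponent j 1) ?G0))"
      proof (rule less.hyps[OF _ _ T _ y])
        show "sum mon_deg (insert (single_exponent j 1) ?G0) < sum mon_deg G"
          by (rule sum_mon_deg_insert_single_exponent[OF G_fin nonlinear(1) j(2) nonlinear(2)])
        show "\<forall>g\<in>insert (single_exponent j 1) ?G0. \<forall>i<d. g i \<noteq> 0 \<longrightarrow> i \<in> T"
          using supp \<open>j \<in> T\<close> by auto
      qed (use G_fin in simp)
      show "nonzerodivisor_mod y (mon_ideal (lower_exponent j ` G))"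
      proof (rule less.hyps[OF sum_mon_deg_lower_exponent[OF G_fin nonlinear(1) j] _ T _ y])
        show "\<forall>g\<in>lower_exponent j ` G. \<forall>i<d. g i \<noteq> 0 \<longrightarrow> i \<in> T"
          using supp by (auto simp: lower_exponent_def)
      qed (use G_fin in simp)
    qed
  qed
qed

lemma nonzerodivisor_mod_mon_ideal:
  assumes "T \<subseteq> {..<d}" "\<forall>g\<in>G. \<forall>i<d. g i \<noteq> 0 \<longrightarrow> i \<in> T" "y \<in> carrier R" "y \<notin> param_ideal T"
  shows "nonzerodivisor_mod y (mon_ideal G)"
proof -
  have "u \<in> mon_ideal G" if u: "u \<in> carrier R" "y \<otimes> u \<in> mon_ideal G" for u
  proof -
    obtain H where H: "finite H" "H \<subseteq> G" "y \<otimes> u \<in> mon_ideal H"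
      by (rule mon_ideal_finite_subset[OF u(2)])
    have "\<forall>g\<in>H. \<forall>i<d. g i \<noteq> 0 \<longrightarrow> i \<in> T" using assms(2) H(2) by blast
    then have "nonzerodivisor_mod y (mon_ideal H)"
      by (rule nonzerodivisor_mod_mon_ideal_finite[OF H(1) assms(1) _ assms(3,4)])
    then show ?thesis using u(1) H(3) mon_ideal_mono[OF H(2)] by (auto simp: nonzerodivisor_mod_def)
  qed
  then show ?thesis using assms(3) by (simp add: nonzerodivisor_mod_def)
qed

lemma colon_x:
  assumes "j < d" "u \<in> carrier R" "x j \<otimes> u \<in> mon_ideal G"
  shows "u \<in> mon_ideal (lower_exponent j ` G)"
proof -
  have "nonzerodivisor_mod (x j) (mon_ideal {g \<in> G. g j = 0})"
    using assms(1) x_closed x_notin_Idl_x[of "{..<d} - {j}" j]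
    by (intro nonzerodivisor_mod_mon_ideal[of "{..<d} - {j}"]) auto
  then show ?thesis by (rule colon_x_if_nonzerodivisor[OF assms(1) _ assms(2,3)])
qed

lemma colon_mon:
  assumes "u \<in> carrier R" "mon f \<otimes> u \<in> mon_ideal G"
  shows "u \<in> mon_ideal ((\<lambda>g. g - f) ` G)"
  using assms
proof (induction "mon_deg f" arbitrary: f G)
  case 0
  then have "mon f = \<one>" by (intro mon_zero) (simp add: mon_deg_eq_0_iff)
  then have "u \<in> mon_ideal G" using 0 by simp
  moreover have "mon_ideal G \<subseteq> mon_ideal ((\<lambda>g. g - f) ` G)"
    by (rule mon_ideal_subset) force
  ultimately show ?case by blast
next
  case (Suc n)
  have "\<not> (\<forall>i<d. f i = 0)" using Suc.hyps(2) mon_deg_eq_0_iff[of f] by simp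
  then obtain i where i: "i < d" "f i \<noteq> 0" by blast
  let ?f = "lower_exponent i f"
  have "mon_deg f = Suc (mon_deg ?f)"
    using i
    by (simp add: mon_deg_def lower_exponent_def sum.remove[of "{..<d}" i] cong: sum.cong_simp)
  then have n: "n = mon_deg ?f" using Suc.hyps(2) by simp
  have "x i \<otimes> (mon ?f \<otimes> u) \<in> mon_ideal G"
    using Suc.prems mon_lower_exponent[of i f] i x_closed by (simp add: m_assoc)
  then have "mon ?f \<otimes> u \<in> mon_ideal (lower_exponent i ` G)"
    using Suc.prems i by (intro colon_x) auto
  then have "u \<in> mon_ideal ((\<lambda>g. g - ?f) ` lower_exponent i ` G)"
    by (rule Suc.hyps(1)[OF n Suc.prems(1)])
  moreover have "lower_exponent i g - ?f = g - f" for g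
    using i by (auto simp: lower_exponent_def fun_eq_iff)
  ultimately show ?case by (simp add: image_image)
qed

lemma coefficient_in_param_ideal:
  assumes S: "S \<subseteq> {..<d}" and G: "\<And>g. g \<in> G \<Longrightarrow> \<exists>i\<in>S. f i < g i"
    and u: "u \<in> carrier R" "mon f \<otimes> u \<in> mon_ideal G"
  shows "u \<in> param_ideal S"
proof -
  have "mon (g - f) \<in> param_ideal S" if "g \<in> G" for g
    using G[OF that] mon_in_param_ideal[OF S, of _ "g - f"] by auto
  then have "mon_ideal ((\<lambda>g. g - f) ` G) \<subseteq> param_ideal S"
    by (intro genideal_minimal param_ideal_ideal[OF S]) auto
  then show ?thesis using colon_mon[OF u] by blast
qed

lemma mon_notin_mon_ideal:
  assumes "\<And>g. g \<in> G \<Longrightarrow> \<exists>i<d. f i < g i"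
  shows "mon f \<notin> mon_ideal G"
proof
  assume "mon f \<in> mon_ideal G"
  then have "\<one> \<in> param_ideal {..<d}"
    using assms by (intro coefficient_in_param_ideal[of _ G f]) auto
  then show False using one_notin_param_ideal by blast
qed

end

subsection \<open>Irreducible components\<close>

context monomial_system
begin

lemma mon_ideal_insert_add_coprime:
  assumes coprime: "\<And>i. i < d \<Longrightarrow> e i = 0 \<or> f i = 0"
    and r: "r \<in> mon_ideal (insert e G)" "r \<in> mon_ideal (insert f G)"
  shows "r \<in> mon_ideal (insert (e + f) G)"
proof -
  obtain h u where "h \<in> mon_ideal G" and u: "u \<in> carrier R" and r_eq: "r = h \<oplus> u \<otimes> mon e"
    by (rule mon_ideal_insertE[OF r(1)])
  then have h: "h \<in> mon_ideal (insert g G)" "h \<in> carrier R" for g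
    using mon_ideal_mono[of G "insert g G"] mon_ideal_carrier by blast+
  have "r \<ominus> h \<in> mon_ideal (insert f G)" by (rule ideal_minus_closed[OF mon_ideal_ideal r(2) h(1)])
  moreover have "r \<ominus> h = mon e \<otimes> u" unfolding r_eq using h(2) u mon_closed[of e] by algebra
  ultimately have "mon e \<otimes> u \<in> mon_ideal (insert f G)" by (simp only:)
  then have "u \<in> mon_ideal ((\<lambda>g. g - e) ` insert f G)" by (rule colon_mon[OF u])
  then have "mon e \<otimes> u \<in> mon_ideal (insert (e + f) G)"
  proof (rule mon_mult_mon_ideal[rotated])
    fix g' assume "g' \<in> (\<lambda>g. g - e) ` insert f G"
    then consider (new) "g' = f - e" | (old) g where "g \<in> G" "g' = g - e" by blast
    then show "\<exists>h\<in>insert (e + f) G. \<forall>i<d. h i \<le> e i + g' i"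
    proof cases
      case new
      then show ?thesis using coprime by (intro bexI[of _ "e + f"]) fastforce+
    next
      case old
      then show ?thesis by (intro bexI[of _ g]) auto
    qed
  qed
  then have "u \<otimes> mon e \<in> mon_ideal (insert (e + f) G)" using m_comm[OF u mon_closed] by simp
  then show ?thesis unfolding r_eq by (rule ideal_add_closed[OF mon_ideal_ideal h(1)])
qed

lemma mon_ideal_insert_if_prime_powers:
  assumes "r \<in> carrier R" "\<And>i. i < d \<Longrightarrow> r \<in> mon_ideal (insert (single_exponent i (g i)) G)"
  shows "r \<in> mon_ideal (insert g G)"
proof -
  let ?g = "\<lambda>n i. if i < n then g i else 0"
  have "r \<in> mon_ideal (insert (?g n) G)" if "n \<le> d" for n
    using that
  proof (induction n)
    case 0
    then show ?case using assms(1) mon_ideal_eq_carrier[of "?g 0" "insert (?g 0) G"] by simp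
  next
    case (Suc n)
    have "?g (Suc n) = ?g n + single_exponent n (g n)" by (auto simp: fun_eq_iff less_Suc_eq)
    moreover have "r \<in> mon_ideal (insert (?g n + single_exponent n (g n)) G)"
      using Suc assms(2)[of n] by (intro mon_ideal_insert_add_coprime) auto
    ultimately show ?case by (simp only:)
  qed
  then have "r \<in> mon_ideal (insert (?g d) G)" by simp
  moreover have "mon_ideal (insert (?g d) G) \<subseteq> mon_ideal (insert g G)"
    by (rule mon_ideal_subset) auto
  ultimately show ?thesis by blast
qed

lemma exists_prime_power_choice:
  assumes "finite G" "r \<in> carrier R" "r \<notin> mon_ideal (H \<union> G)"
  shows "\<exists>c. (\<forall>g\<in>G. c g < d) \<and> r \<notin> mon_ideal (H \<union> (\<lambda>g. single_exponent (c g) (g (c g))) ` G)"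
  using assms(1,3)
proof (induction G arbitrary: H rule: finite_induct)
  case empty
  then show ?case by simp
next
  case (insert g G)
  obtain i where i: "i < d" "r \<notin> mon_ideal (insert (single_exponent i (g i)) (H \<union> G))"
    using mon_ideal_insert_if_prime_powers[OF assms(2), of g "H \<union> G"] insert.prems by auto
  then obtain c where c: "\<forall>g\<in>G. c g < d"
    "r \<notin> mon_ideal (insert (single_exponent i (g i)) H \<union> (\<lambda>g. single_exponent (c g) (g (c g))) ` G)"
    using insert.IH[of "insert (single_exponent i (g i)) H"] by (auto simp only: Un_insert_left)
  let ?c = "c(g := i)"
  have "(\<lambda>h. single_exponent (?c h) (h (?c h))) ` insert g G =
      insert (single_exponent i (g i)) ((\<lambda>h. single_exponent (c h) (h (c h))) ` G)"
    unfolding image_insert using insert.hyps(2)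
    by (intro arg_cong2[where f = insert] image_cong)
      (auto simp only: fun_upd_apply split: if_splits)
  then show ?case
    using c i(1) by (intro exI[of _ ?c]) (simp only: Un_insert_left Un_insert_right, simp)
qed

lemma irreducible_component_finite:
  assumes G: "finite G" and r: "r \<in> carrier R" "r \<notin> mon_ideal G"
  obtains S b where "S \<subseteq> {..<d}" "\<And>g. g \<in> G \<Longrightarrow> \<exists>i\<in>S. b i < g i"
    "r \<notin> mon_ideal (irreducible_exponents S b)"
proof -
  obtain c where c: "\<And>g. g \<in> G \<Longrightarrow> c g < d"
    "r \<notin> mon_ideal ((\<lambda>g. single_exponent (c g) (g (c g))) ` G)" (is "r \<notin> mon_ideal ?Q")
    using exists_prime_power_choice[OF G r(1), of "{}"] r(2) by auto
  have pos: "0 < g (c g)" if "g \<in> G" for g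
  proof (rule ccontr)
    assume "\<not> 0 < g (c g)"
    then have "mon_ideal ?Q = carrier R"
      using that by (intro mon_ideal_eq_carrier[of "single_exponent (c g) (g (c g))"] imageI) auto
    then show False using c(2) r(1) by simp
  qed
  define m where "m i = Min ((\<lambda>g. g i) ` {g \<in> G. c g = i})" for i
  have m_le: "m (c g) \<le> g (c g)" if "g \<in> G" for g
    unfolding m_def using that G by (intro Min_le) auto
  have m_attained: "\<exists>g\<in>G. c g = i \<and> g i = m i" if "i \<in> c ` G" for i
  proof -
    have "m i \<in> (\<lambda>g. g i) ` {g \<in> G. c g = i}"
      unfolding m_def using that G by (intro Min_in) auto
    then show ?thesis by auto
  qed
  have m_pos: "0 < m i" if "i \<in> c ` G" for i using m_attained[OF that] pos by metis
  show thesis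
  proof (rule that[of "c ` G" "\<lambda>i. m i - 1"])
    show "c ` G \<subseteq> {..<d}" using c(1) by auto
    show "\<exists>i\<in>c ` G. m i - 1 < g i" if "g \<in> G" for g
      using m_le[OF that] m_pos[of "c g"] that by (intro bexI[of _ "c g"]) auto
    have "single_exponent i (Suc (m i - 1)) \<in> ?Q" if i: "i \<in> c ` G" for i
    proof -
      obtain g where "g \<in> G" "c g = i" "g i = m i" using m_attained[OF i] by blast
      then show ?thesis using m_pos[OF i] by (intro image_eqI[of _ _ g]) simp_all
    qed
    then have "irreducible_exponents (c ` G) (\<lambda>i. m i - 1) \<subseteq> ?Q" by blast
    then show "r \<notin> mon_ideal (irreducible_exponents (c ` G) (\<lambda>i. m i - 1))"
      using c(2) mon_ideal_mono by blast
  qed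
qed

end

locale noetherian_monomial_system = monomial_system + noetherian_domain
begin

lemma mon_ideal_finite_generators:
  obtains G where "finite G" "G \<subseteq> K" "mon_ideal G = mon_ideal K"
  using noetherian_Idl_finite_generators[OF noetherian_ring_axioms mon_image_closed]
    finite_subset_image by metis

lemma irreducible_component:
  assumes r: "r \<in> carrier R" "r \<notin> mon_ideal K"
  obtains S b where "S \<subseteq> {..<d}" "\<And>g. g \<in> K \<Longrightarrow> \<exists>i\<in>S. b i < g i"
    "r \<notin> mon_ideal (irreducible_exponents S b)"
proof -
  obtain G where G: "finite G" "G \<subseteq> K" "mon_ideal G = mon_ideal K"
    by (rule mon_ideal_finite_generators)
  have r_notin: "r \<notin> mon_ideal G" using r(2) G(3) by simp
  obtain S b where S: "S \<subseteq> {..<d}" and b: "\<And>g. g \<in> G \<Longrightarrow> \<exists>i\<in>S. b i < g i"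
    and omitted: "r \<notin> mon_ideal (irreducible_exponents S b)"
    using irreducible_component_finite[OF G(1) r(1) r_notin] by blast
  have "\<exists>i\<in>S. b i < g i" if "g \<in> K" for g
  proof -
    have "mon g \<in> mon_ideal G" unfolding G(3) using that by (intro mon_in_mon_ideal) auto
    then obtain h where "h \<in> G" "\<forall>i<d. h i \<le> g i" using mon_notin_mon_ideal[of G g] by (meson not_le)
    then show ?thesis using b[of h] S by (meson lessThan_iff less_le_trans subsetD)
  qed
  then show thesis using that S omitted by blast
qed

end

section \<open>Generic separating weights\<close>

lemma exists_between_finite_avoiding_countable:
  fixes L U Z :: "real set"
  assumes "finite L" "finite U" "L \<noteq> {}" "\<And>a b. a \<in> L \<Longrightarrow> b \<in> U \<Longrightarrow> a < b" "countable Z"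
  obtains t where "\<And>a. a \<in> L \<Longrightarrow> a < t" "\<And>b. b \<in> U \<Longrightarrow> t < b" "t \<notin> Z"
proof -
  define upper where "upper = (if U = {} then Max L + 1 else Min U)"
  have "Max L < upper"
    using assms(4)[OF Max_in[OF assms(1,3)] Min_in[OF assms(2)]] by (simp add: upper_def)
  then have "uncountable {Max L<..<upper}" by (simp add: uncountable_open_interval)
  then obtain t where t: "t \<in> {Max L<..<upper}" "t \<notin> Z"
    using countable_subset[OF _ assms(5)] by blast
  show thesis
  proof (rule that[of t])
    show "a < t" if "a \<in> L" for a using t(1) Max_ge[OF assms(1) that] by simp
    show "t < b" if "b \<in> U" for b
      using t(1) Min_le[OF assms(2) that] that by (auto simp: upper_def split: if_splits)
  qed (rule t(2))
qed

lemma Fourier_Motzkin_step: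
  fixes p q :: "'v \<Rightarrow> real"
  assumes fin: "finite V"
    and nonpos: "\<And>v. v \<in> V \<Longrightarrow> q v \<le> 0 \<Longrightarrow> 0 < p v"
    and opposite: "\<And>a b. a \<in> V \<Longrightarrow> 0 < q a \<Longrightarrow> b \<in> V \<Longrightarrow> q b < 0 \<Longrightarrow> 0 < q a * p b - q b * p a"
    and Z: "countable Z"
  obtains t where "0 < t" "t \<notin> Z" "\<And>v. v \<in> V \<Longrightarrow> 0 < t * q v + p v"
proof -
  let ?L = "insert 0 ((\<lambda>a. - p a / q a) ` {a \<in> V. 0 < q a})"
  let ?U = "(\<lambda>b. p b / - q b) ` {b \<in> V. q b < 0}"
  have bounds: "a < b" if "a \<in> ?L" "b \<in> ?U" for a b
  proof -
    obtain v where v: "v \<in> V" "q v < 0" "b = p v / - q v" using \<open>b \<in> ?U\<close> by blast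
    consider (zero) "a = 0"
      | (ratio) u where "u \<in> V" "0 < q u" "a = - p u / q u" using \<open>a \<in> ?L\<close> by blast
    then show ?thesis
    proof cases
      case zero
      then show ?thesis using v nonpos[of v] by (simp add: divide_pos_neg)
    next
      case ratio
      show ?thesis
        unfolding ratio(3) v(3) using ratio(1,2) v(1,2) opposite[of u v] by (simp add: field_simps)
    qed
  qed
  obtain t where t: "\<And>a. a \<in> ?L \<Longrightarrow> a < t" "\<And>b. b \<in> ?U \<Longrightarrow> t < b" "t \<notin> Z"
    by (rule exists_between_finite_avoiding_countable[OF _ _ _ bounds Z, of ?L ?U]) (use fin in auto)
  have "0 < t * q v + p v" if v: "v \<in> V" for v
  proof -
    consider (zero) "q v = 0" | (pos) "0 < q v" | (neg) "q v < 0" by linarith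
    then show ?thesis
    proof cases
      case zero
      then show ?thesis using nonpos[OF v] by simp
    next
      case pos
      then have "- p v / q v < t" using t(1) v by blast
      then show ?thesis using pos by (simp add: field_simps)
    next
      case neg
      then have "t < p v / - q v" using t(2) v by blast
      then show ?thesis using neg by (simp add: field_simps)
    qed
  qed
  then show thesis using that t by blast
qed

definition generic_weights :: "'i set \<Rightarrow> ('i \<Rightarrow> real) \<Rightarrow> bool" where
  "generic_weights S l \<longleftrightarrow> (\<forall>i\<in>S. 0 < l i) \<and>
     (\<forall>z :: 'i \<Rightarrow> int. (\<Sum>i\<in>S. l i * z i) = 0 \<longrightarrow> (\<forall>i\<in>S. z i = 0))"

lemma generic_weightsD:
  fixes z :: "'i \<Rightarrow> int"
  assumes "generic_weights S l" "(\<Sum>i\<in>S. l i * z i) = 0" "i \<in> S"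
  shows "z i = 0"
  using assms unfolding generic_weights_def by auto

lemma sum_insert_fun_upd:
  fixes l v :: "'i \<Rightarrow> real"
  assumes "finite S" "k \<notin> S"
  shows "(\<Sum>i\<in>insert k S. (l(k := t)) i * v i) = t * v k + (\<Sum>i\<in>S. l i * v i)"
  using assms by (auto intro: sum.cong)

lemma countable_nongeneric_extensions:
  fixes l :: "'i \<Rightarrow> real"
  assumes "finite S" "k \<notin> S" "generic_weights S l"
  shows "countable {t. 0 < t \<and> \<not> generic_weights (insert k S) (l(k := t))}"
proof (rule countable_subset)
  let ?root = "\<lambda>z :: 'i \<Rightarrow> int. - (\<Sum>i\<in>S. l i * z i) / z k"
  show "countable (?root ` PiE (insert k S) (\<lambda>_. UNIV))"
    using assms(1) by (intro countable_image countable_PiE) auto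
  show "{t. 0 < t \<and> \<not> generic_weights (insert k S) (l(k := t))} \<subseteq> ?root ` PiE (insert k S) (\<lambda>_. UNIV)"
  proof
    fix t assume "t \<in> {t. 0 < t \<and> \<not> generic_weights (insert k S) (l(k := t))}"
    then obtain z :: "'i \<Rightarrow> int" and j where z: "(\<Sum>i\<in>insert k S. (l(k := t)) i * z i) = 0"
      "j \<in> insert k S" "z j \<noteq> 0"
      using assms(3) unfolding generic_weights_def by (auto split: if_splits)
    then have zero: "t * z k + (\<Sum>i\<in>S. l i * z i) = 0" using sum_insert_fun_upd[OF assms(1,2)] by simp
    then have "z k \<noteq> 0" using assms(3) z(2,3) unfolding generic_weights_def by auto
    then have "t = ?root z" using zero by (simp add: field_simps)
    then have "t = ?root (restrict z (insert k S))" by simp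
    then show "t \<in> ?root ` PiE (insert k S) (\<lambda>_. UNIV)" 
      by (intro image_eqI[of _ _ "restrict z (insert k S)"]) auto
  qed
qed

definition eliminate_coordinate :: "'i \<Rightarrow> ('i \<Rightarrow> real) set \<Rightarrow> ('i \<Rightarrow> real) set" where
  "eliminate_coordinate k V = {v \<in> V. v k \<le> 0} \<union>
     (\<lambda>(a, b) i. a k * b i - b k * a i) ` ({a \<in> V. 0 < a k} \<times> {b \<in> V. b k < 0})"

lemma eliminate_coordinate_subset_cone:
  assumes add: "\<And>y z. y \<in> C \<Longrightarrow> z \<in> C \<Longrightarrow> y + z \<in> C"
    and scale: "\<And>s y. 0 < s \<Longrightarrow> y \<in> C \<Longrightarrow> (\<lambda>i. s * y i) \<in> C"
    and V: "V \<subseteq> C"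
  shows "eliminate_coordinate k V \<subseteq> {y \<in> C. y k \<le> 0}"
proof -
  have "(\<lambda>i. a k * b i - b k * a i) \<in> C" if "a \<in> V" "0 < a k" "b \<in> V" "b k < 0" for a b
  proof -
    have "(\<lambda>i. a k * b i) + (\<lambda>i. - b k * a i) \<in> C" using that V by (intro add scale) auto
    then show ?thesis by (simp add: plus_fun_def)
  qed
  then show ?thesis unfolding eliminate_coordinate_def using V by auto
qed

text \<open>Fourier-Motzkin elimination: a functional on the coordinates other than \<open>k\<close> that is positive
  on \<open>eliminate_coordinate k V\<close> leaves an open interval for its value at \<open>k\<close>, and this interval
  contains generic values.\<close>

lemma exists_generic_positive_functional:
  fixes C :: "('i \<Rightarrow> real) set"
  assumes "finite S" "finite V" "V \<subseteq> C"
    and "\<And>y z. y \<in> C \<Longrightarrow> z \<in> C \<Longrightarrow> y + z \<in> C"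
    and "\<And>s y. 0 < s \<Longrightarrow> y \<in> C \<Longrightarrow> (\<lambda>i. s * y i) \<in> C"
    and "\<And>y. y \<in> C \<Longrightarrow> \<exists>i\<in>S. 0 < y i"
  shows "\<exists>l. generic_weights S l \<and> (\<forall>v\<in>V. 0 < (\<Sum>i\<in>S. l i * v i))"
  using assms
proof (induction S arbitrary: C V rule: finite_induct)
  case empty
  then have "V = {}" by blast
  then show ?case by (simp add: generic_weights_def)
next
  case (insert k S)
  note V = insert.prems(1,2) and add = insert.prems(3) and scale = insert.prems(4)
  have "\<exists>l. generic_weights S l \<and> (\<forall>v\<in>eliminate_coordinate k V. 0 < (\<Sum>i\<in>S. l i * v i))"
  proof (rule insert.IH[OF _ eliminate_coordinate_subset_cone[OF add scale V(2)]])
    show "finite (eliminate_coordinate k V)" unfolding eliminate_coordinate_def using V(1) by auto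
    show "(\<lambda>i. s * y i) \<in> {y \<in> C. y k \<le> 0}" if "0 < s" "y \<in> {y \<in> C. y k \<le> 0}" for s y
      using that scale by (auto simp: mult_nonneg_nonpos)
    show "\<exists>i\<in>S. 0 < y i" if "y \<in> {y \<in> C. y k \<le> 0}" for y
      using insert.prems(5)[of y] that by auto
  qed (use add in auto)
  then obtain l where l: "generic_weights S l"
    "\<And>v. v \<in> eliminate_coordinate k V \<Longrightarrow> 0 < (\<Sum>i\<in>S. l i * v i)" by blast
  obtain t where t: "0 < t" "t \<notin> {t. 0 < t \<and> \<not> generic_weights (insert k S) (l(k := t))}"
    "\<And>v. v \<in> V \<Longrightarrow> 0 < t * v k + (\<Sum>i\<in>S. l i * v i)"
  proof (rule Fourier_Motzkin_step[OF V(1), where q = "\<lambda>v. v k" and p = "\<lambda>v. \<Sum>i\<in>S. l i * v i"])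
    show "countable {t. 0 < t \<and> \<not> generic_weights (insert k S) (l(k := t))}"
      by (rule countable_nongeneric_extensions[OF insert.hyps l(1)])
    show "0 < (\<Sum>i\<in>S. l i * v i)" if "v \<in> V" "v k \<le> 0" for v
      using that by (intro l(2)) (auto simp: eliminate_coordinate_def)
    fix a b assume "a \<in> V" "0 < a k" "b \<in> V" "b k < 0"
    then have "0 < (\<Sum>i\<in>S. l i * (a k * b i - b k * a i))"
      by (intro l(2)) (auto simp: eliminate_coordinate_def)
    also have "\<dots> = a k * (\<Sum>i\<in>S. l i * b i) - b k * (\<Sum>i\<in>S. l i * a i)"
      unfolding sum_distrib_left sum_subtractf[symmetric]
      by (rule sum.cong) (auto simp: algebra_simps)
    finally show "0 < a k * (\<Sum>i\<in>S. l i * b i) - b k * (\<Sum>i\<in>S. l i * a i)" .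
  qed blast
  then show ?case
    using sum_insert_fun_upd[OF insert.hyps]
    by (intro exI[of _ "l(k := t)"]) (simp del: fun_upd_apply)
qed

lemma Ville_alternative_generic:
  fixes v :: "'a \<Rightarrow> 'i \<Rightarrow> real"
  assumes "finite S" "finite A"
    and no_nonpos: "\<And>lam. (\<forall>a\<in>A. 0 \<le> lam a) \<Longrightarrow> 0 < (\<Sum>a\<in>A. lam a) \<Longrightarrow> \<exists>i\<in>S. 0 < (\<Sum>a\<in>A. lam a * v a i)"
  obtains l where "generic_weights S l" "\<And>a. a \<in> A \<Longrightarrow> 0 < (\<Sum>i\<in>S. l i * v a i)"
proof -
  define C where "C = {\<lambda>i. \<Sum>a\<in>A. lam a * v a i | lam. (\<forall>a\<in>A. 0 \<le> lam a) \<and> 0 < (\<Sum>a\<in>A. lam a)}"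
  have C_intro: "y \<in> C"
    if "\<And>a. a \<in> A \<Longrightarrow> 0 \<le> lam a" "0 < (\<Sum>a\<in>A. lam a)" "\<And>i. y i = (\<Sum>a\<in>A. lam a * v a i)" for y lam
    unfolding C_def using that by blast
  have C_elim: "\<exists>lam. (\<forall>a\<in>A. 0 \<le> lam a) \<and> 0 < (\<Sum>a\<in>A. lam a) \<and> (\<forall>i. y i = (\<Sum>a\<in>A. lam a * v a i))"
    if "y \<in> C" for y
    using that unfolding C_def by auto
  have "\<exists>l. generic_weights S l \<and> (\<forall>y\<in>v ` A. 0 < (\<Sum>i\<in>S. l i * y i))"
  proof (rule exists_generic_positive_functional)
    show "v ` A \<subseteq> C"
    proof clarify
      fix a assume "a \<in> A"
      then show "v a \<in> C"
        using assms(2) by (intro C_intro[of "\<lambda>b. if b = a then 1 else 0"])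
          (auto simp: if_distrib[where f = "\<lambda>z. z * _"] cong: if_cong)
    qed
    show "\<exists>i\<in>S. 0 < y i" if "y \<in> C" for y using C_elim[OF that] no_nonpos by metis
  next
    fix y z assume "y \<in> C" "z \<in> C"
    then obtain lam mu where "\<forall>a\<in>A. 0 \<le> lam a" "0 < (\<Sum>a\<in>A. lam a)" "\<forall>i. y i = (\<Sum>a\<in>A. lam a * v a i)"
      "\<forall>a\<in>A. 0 \<le> mu a" "0 < (\<Sum>a\<in>A. mu a)" "\<forall>i. z i = (\<Sum>a\<in>A. mu a * v a i)"
      using C_elim by meson
    then show "y + z \<in> C"
      by (intro C_intro[of "\<lambda>a. lam a + mu a"]) (auto simp: sum.distrib distrib_right)
  next
    fix s y assume "0 < (s :: real)" "y \<in> C"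
    then obtain lam where "\<forall>a\<in>A. 0 \<le> lam a" "0 < (\<Sum>a\<in>A. lam a)" "\<forall>i. y i = (\<Sum>a\<in>A. lam a * v a i)"
      using C_elim by meson
    then show "(\<lambda>i. s * y i) \<in> C"
      using \<open>0 < s\<close>
      by (intro C_intro[of "\<lambda>a. s * lam a"]) (auto simp: mult.assoc simp flip: sum_distrib_left)
  qed (use assms in auto)
  then show thesis using that by blast
qed

section \<open>Leading terms\<close>

locale weighted_monomial_system = monomial_system +
  fixes S :: "nat set" and l :: "nat \<Rightarrow> real"
  assumes S_subset: "S \<subseteq> {..<d}" and generic: "generic_weights S l"
begin

definition wt :: "(nat \<Rightarrow> nat) \<Rightarrow> real" where
  "wt e = (\<Sum>i\<in>S. l i * real (e i))"

abbreviation filt :: "real \<Rightarrow> 'a set" where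
  "filt c \<equiv> mon_ideal {e. c \<le> wt e}"

abbreviation filt_strict :: "real \<Rightarrow> 'a set" where
  "filt_strict c \<equiv> mon_ideal {e. c < wt e}"

lemma finite_S: "finite S"
  using S_subset finite_subset by blast

lemma l_pos: "i \<in> S \<Longrightarrow> 0 < l i"
  using generic by (simp add: generic_weights_def)

lemma wt_zero [simp]: "wt 0 = 0"
  by (simp add: wt_def)

lemma wt_add: "wt (e + f) = wt e + wt f"
  by (simp add: wt_def distrib_left sum.distrib)

lemma wt_mult: "wt (\<lambda>i. k * e i) = real k * wt e"
  by (simp add: wt_def sum_distrib_left mult.left_commute)

lemma wt_nonneg: "0 \<le> wt e"
  unfolding wt_def by (intro sum_nonneg mult_nonneg_nonneg less_imp_le[OF l_pos]) auto

lemma wt_mono: "(\<And>i. i \<in> S \<Longrightarrow> e i \<le> f i) \<Longrightarrow> wt e \<le> wt f"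
  unfolding wt_def by (intro sum_mono mult_left_mono) (auto intro: less_imp_le l_pos)

lemma wt_less_imp: "wt e < wt f \<Longrightarrow> \<exists>i\<in>S. e i < f i"
  using wt_mono[of f e] by (meson not_less)

lemma wt_cong: "(\<And>i. i \<in> S \<Longrightarrow> e i = f i) \<Longrightarrow> wt e = wt f"
  unfolding wt_def by (auto intro: sum.cong)

lemma wt_single_exponent: "i \<in> S \<Longrightarrow> wt (single_exponent i k) = l i * real k"
  unfolding wt_def using finite_S by (simp add: if_distrib[of "\<lambda>z. l _ * real z"] cong: if_cong)

lemma wt_eqD:
  assumes "wt e = wt f" "i \<in> S"
  shows "e i = f i"
proof -
  let ?z = "\<lambda>i. int (e i) - int (f i)"
  have "(\<Sum>i\<in>S. l i * ?z i) = 0"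
    using assms(1) by (simp add: wt_def right_diff_distrib sum_subtractf)
  then have "?z i = 0" by (rule generic_weightsD[OF generic _ assms(2)])
  then show ?thesis by simp
qed

lemma finite_wt_le: "finite {wt e | e. wt e \<le> c}"
proof -
  define N where "N = nat \<lceil>\<Sum>i\<in>S. \<bar>c\<bar> / l i\<rceil>"
  have "{wt e | e. wt e \<le> c} \<subseteq> wt ` PiE S (\<lambda>_. {..N})"
  proof
    fix v assume "v \<in> {wt e | e. wt e \<le> c}"
    then obtain e where e: "v = wt e" "wt e \<le> c" by blast
    have "e i \<le> N" if i: "i \<in> S" for i
    proof -
      have "l i * real (e i) \<le> wt e"
        unfolding wt_def using i finite_S
        by (intro member_le_sum) (auto intro!: mult_nonneg_nonneg less_imp_le[OF l_pos])
      then have "real (e i) \<le> \<bar>c\<bar> / l i" using e(2) l_pos[OF i] by (simp add: field_simps)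
      also have "\<dots> \<le> (\<Sum>i\<in>S. \<bar>c\<bar> / l i)"
        using i finite_S by (intro member_le_sum) (auto intro!: divide_nonneg_pos l_pos)
      finally show ?thesis unfolding N_def by linarith
    qed
    then have "restrict e S \<in> PiE S (\<lambda>_. {..N})" by auto
    moreover have "v = wt (restrict e S)" unfolding e(1) by (rule wt_cong) simp
    ultimately show "v \<in> wt ` PiE S (\<lambda>_. {..N})" by blast
  qed
  then show ?thesis by (rule finite_subset) (intro finite_imageI finite_PiE finite_S, auto)
qed

lemma filt_strict_subset_filt: "filt_strict c \<subseteq> filt c"
  by (rule mon_ideal_mono) auto

lemma filt_subset_filt_strict: "c < c' \<Longrightarrow> filt c' \<subseteq> filt_strict c"
  by (rule mon_ideal_mono) auto

lemma filt_zero: "filt 0 = carrier R"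
  by (rule mon_ideal_eq_carrier[of 0]) auto

lemma filt_prod: "(filt c) \<cdot> (filt c') \<subseteq> filt (c + c')"
  unfolding mon_ideal_prod by (rule mon_ideal_mono) (auto simp: set_plus_def wt_add)

lemma filt_mult: "a \<in> filt c \<Longrightarrow> b \<in> filt c' \<Longrightarrow> a \<otimes> b \<in> filt (c + c')"
  using subsetD[OF filt_prod ideal_prod.prod] .

lemma filt_strict_mult:
  assumes "a \<in> filt_strict c" "b \<in> filt c'"
  shows "a \<otimes> b \<in> filt_strict (c + c')"
proof -
  have "(filt_strict c) \<cdot> (filt c') \<subseteq> filt_strict (c + c')"
    unfolding mon_ideal_prod by (rule mon_ideal_mono) (auto simp: set_plus_def wt_add)
  then show ?thesis using ideal_prod.prod[OF assms] by blast
qed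

lemma mon_in_filt: "c \<le> wt e \<Longrightarrow> mon e \<in> filt c"
  by (rule mon_in_mon_ideal[of e]) auto

lemma filt_subset_insert_filt_strict:
  assumes "\<And>i. i \<notin> S \<Longrightarrow> f i = 0"
  shows "filt (wt f) \<subseteq> mon_ideal (insert f {e. wt f < wt e})"
proof (rule mon_ideal_subset)
  fix e assume "e \<in> {e. wt f \<le> wt e}"
  then consider (equal) "wt e = wt f" | (less) "wt f < wt e" by fastforce
  then show "\<exists>h\<in>insert f {e. wt f < wt e}. \<forall>i<d. h i \<le> e i"
  proof cases
    case equal
    then have "f i \<le> e i" for i using wt_eqD[of e f i] assms[of i] by (cases "i \<in> S") auto
    then show ?thesis by blast
  next
    case less
    then show ?thesis by blast
  qed
qed

lemma mon_mult_param_ideal: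
  assumes "u \<in> param_ideal S"
  shows "mon f \<otimes> u \<in> filt_strict (wt f)"
proof (rule mult_Idl_subset[OF _ mon_ideal_ideal mon_closed _ assms])
  show "x ` S \<subseteq> carrier R" using S_subset x_closed by auto
  fix a assume "a \<in> x ` S"
  then obtain i where i: "i \<in> S" "a = x i" by blast
  then have "i < d" using S_subset by blast
  then have "mon f \<otimes> a = mon (f + single_exponent i 1)"
    using i(2) x_closed mon_single_exponent[of i 1] by (simp add: mon_add)
  also have "\<dots> \<in> filt_strict (wt f)"
    using l_pos[OF i(1)] wt_single_exponent[OF i(1), of 1]
    by (intro mon_in_mon_ideal[of "f + single_exponent i 1"]) (auto simp: wt_add)
  finally show "mon f \<otimes> a \<in> filt_strict (wt f)" .
qed

lemma coefficient_notin_filt_strict: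
  assumes "u \<in> carrier R" "u \<notin> param_ideal S"
  shows "mon f \<otimes> u \<notin> filt_strict (wt f)"
  using coefficient_in_param_ideal[OF S_subset _ assms(1), of "{e. wt f < wt e}" f]
    assms(2) wt_less_imp by blast

definition has_leading_term :: "'a \<Rightarrow> 'a \<Rightarrow> (nat \<Rightarrow> nat) \<Rightarrow> bool" where
  "has_leading_term r u f \<longleftrightarrow> u \<in> carrier R \<and> u \<notin> param_ideal S \<and>
     (\<exists>s\<in>filt_strict (wt f). r = s \<oplus> mon f \<otimes> u)"

lemma has_leading_termE:
  assumes "has_leading_term r u f"
  obtains s where "u \<in> carrier R" "u \<notin> param_ideal S" "s \<in> filt_strict (wt f)" "s \<in> carrier R"
    "r = s \<oplus> mon f \<otimes> u"
  using assms mon_ideal_carrier unfolding has_leading_term_def by blast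

lemma leading_term_in_filt:
  assumes "has_leading_term r u f"
  shows "r \<in> filt (wt f)"
  using assms
proof (rule has_leading_termE)
  fix s assume s: "u \<in> carrier R" "s \<in> filt_strict (wt f)" "r = s \<oplus> mon f \<otimes> u"
  show ?thesis
    unfolding s(3) using s(1,2) filt_strict_subset_filt
    by (intro ideal_add_closed[OF mon_ideal_ideal]
        ideal.I_r_closed[OF mon_ideal_ideal mon_in_filt]) auto
qed

lemma leading_term_notin_filt_strict:
  assumes "has_leading_term r u f"
  shows "r \<notin> filt_strict (wt f)"
proof
  assume r: "r \<in> filt_strict (wt f)"
  obtain s where s: "u \<in> carrier R" "u \<notin> param_ideal S" "s \<in> filt_strict (wt f)" "s \<in> carrier R"
    "r = s \<oplus> mon f \<otimes> u" by (rule has_leading_termE[OF assms])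
  have "r \<ominus> s \<in> filt_strict (wt f)" by (rule ideal_minus_closed[OF mon_ideal_ideal r s(3)])
  moreover have "r \<ominus> s = mon f \<otimes> u" unfolding s(5) using s(1,4) mon_closed[of f] by algebra
  ultimately show False using coefficient_notin_filt_strict[OF s(1,2)] by simp
qed

lemma has_leading_term_mult:
  assumes "has_leading_term r u f" "has_leading_term r' u' f'"
  shows "has_leading_term (r \<otimes> r') (u \<otimes> u') (f + f')"
proof -
  obtain s where s: "u \<in> carrier R" "u \<notin> param_ideal S" "s \<in> filt_strict (wt f)" "s \<in> carrier R"
    "r = s \<oplus> mon f \<otimes> u" by (rule has_leading_termE[OF assms(1)])
  obtain s' where s': "u' \<in> carrier R" "u' \<notin> param_ideal S" "s' \<in> filt_strict (wt f')" "s' \<in> carrier R"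
    "r' = s' \<oplus> mon f' \<otimes> u'" by (rule has_leading_termE[OF assms(2)])
  note carrier = s(1,4) s'(1,4) mon_closed[of f] mon_closed[of f']
  have "r \<otimes> r' = (s \<otimes> r' \<oplus> s' \<otimes> (mon f \<otimes> u)) \<oplus> mon (f + f') \<otimes> (u \<otimes> u')"
    unfolding s(5) s'(5) mon_add using carrier by algebra
  moreover have "s \<otimes> r' \<in> filt_strict (wt (f + f'))"
    unfolding wt_add by (rule filt_strict_mult[OF s(3) leading_term_in_filt[OF assms(2)]])
  moreover have "mon f \<otimes> u \<in> filt (wt f)"
    using s(1) by (intro ideal.I_r_closed[OF mon_ideal_ideal mon_in_filt]) auto
  then have "s' \<otimes> (mon f \<otimes> u) \<in> filt_strict (wt (f + f'))"
    using filt_strict_mult[OF s'(3)] by (simp add: wt_add add.commute)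
  moreover have "u \<otimes> u' \<notin> param_ideal S"
    using primeideal.I_prime[OF primeideal_Idl_x[OF S_subset] s(1) s'(1)] s(2) s'(2) by blast
  ultimately show ?thesis
    unfolding has_leading_term_def using s(1) s'(1) ideal_add_closed[OF mon_ideal_ideal] by blast
qed

lemma has_leading_term_pow:
  assumes "has_leading_term r u f"
  shows "has_leading_term (r [^] n) (u [^] n) (\<lambda>i. n * f i)"
proof (induction n)
  case 0
  have "mon (\<lambda>i. 0 * f i) = \<one>" by (rule mon_zero) simp
  then show ?case
    unfolding has_leading_term_def
    using ideal_zero_closed[OF mon_ideal_ideal] one_notin_param_ideal[OF S_subset]
    by (intro conjI bexI[of _ \<zero>]) simp_all
next
  case (Suc n)
  have "(\<lambda>i. n * f i) + f = (\<lambda>i. Suc n * f i)" by (simp add: fun_eq_iff)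
  then show ?case using has_leading_term_mult[OF Suc assms] by simp
qed

lemma filt_jump:
  assumes "0 < wt f"
  obtains g where "wt g < wt f" "filt_strict (wt g) \<subseteq> filt (wt f)"
proof -
  define V where "V = {wt e | e. wt e < wt f}"
  have V_finite: "finite V"
    by (rule finite_subset[OF _ finite_wt_le[of "wt f"]]) (auto simp: V_def)
  have "wt 0 \<in> V" unfolding V_def using assms wt_zero by (metis (mono_tags, lifting) mem_Collect_eq)
  then have "Max V \<in> V" using V_finite Max_in by blast
  then obtain g where g: "Max V = wt g" "wt g < wt f" unfolding V_def by blast
  have "wt f \<le> wt e" if "wt g < wt e" for e
  proof (rule ccontr)
    assume "\<not> wt f \<le> wt e"
    then have "wt e \<in> V" by (auto simp: V_def)
    then show False using Max_ge[OF V_finite, of "wt e"] g(1) that by linarith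
  qed
  then have "filt_strict (wt g) \<subseteq> filt (wt f)" by (intro mon_ideal_mono) auto
  then show thesis using that g(2) by blast
qed

lemma exists_leading_term:
  assumes r: "r \<in> carrier R" "r \<notin> filt_strict (wt b)"
  obtains u f where "has_leading_term r u f" "wt f \<le> wt b"
proof -
  define W where "W = {wt e | e. wt e \<le> wt b \<and> r \<notin> filt_strict (wt e)}"
  have W_finite: "finite W"
    by (rule finite_subset[OF _ finite_wt_le[of "wt b"]]) (auto simp: W_def)
  have "wt b \<in> W" using r(2) by (auto simp: W_def)
  then have "Min W \<in> W" using W_finite by (intro Min_in) auto
  then obtain f' where f': "wt f' = Min W" "wt f' \<le> wt b" "r \<notin> filt_strict (wt f')" by (auto simp: W_def)
  define f where "f i = (if i \<in> S then f' i else 0)" for i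
  have wt_f: "wt f = wt f'" by (rule wt_cong) (simp add: f_def)
  have "r \<in> filt (wt f)"
  proof (cases "0 < wt f")
    case True
    then obtain g where g: "wt g < wt f" "filt_strict (wt g) \<subseteq> filt (wt f)" by (rule filt_jump)
    then have "wt g \<notin> W" using Min_le[OF W_finite, of "wt g"] f'(1) wt_f by linarith
    then have "r \<in> filt_strict (wt g)" using g(1) f'(2) wt_f by (auto simp: W_def)
    then show ?thesis using g(2) by blast
  next
    case False
    then have "wt f = 0" using wt_nonneg[of f] by linarith
    then show ?thesis using r(1) filt_zero by simp
  qed
  then have "r \<in> mon_ideal (insert f {e. wt f < wt e})"
    using filt_subset_insert_filt_strict[of f] by (auto simp: f_def)
  then obtain s u where s: "s \<in> filt_strict (wt f)" and u: "u \<in> carrier R" and "r = s \<oplus> u \<otimes> mon f"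
    by (rule mon_ideal_insertE)
  then have r_eq: "r = s \<oplus> mon f \<otimes> u" by (simp add: m_comm)
  have "u \<notin> param_ideal S"
    using ideal_add_closed[OF mon_ideal_ideal s mon_mult_param_ideal] f'(3) wt_f r_eq by metis
  then have "has_leading_term r u f" using s u r_eq unfolding has_leading_term_def by blast
  then show thesis using that f'(2) wt_f by simp
qed

text \<open>If \<open>J\<close> had larger weight than \<open>y\<close>, then \<open>y\<^bsup>n\<^esup>\<close> would be the only term of smallest weight in
  an equation \<open>y\<^bsup>n\<^esup> + a\<^sub>1 y\<^bsup>n-1\<^esup> + \<dots> + a\<^sub>n = 0\<close> with \<open>a\<^sub>i \<in> J\<^sup>i\<close>.\<close>

lemma integral_weight_bound:
  assumes J: "ideal J R" "J \<subseteq> filt c" and y: "y \<in> int_closure R J" "has_leading_term y u f"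
  shows "c \<le> wt f"
proof (rule ccontr)
  assume "\<not> c \<le> wt f"
  have y_closed: "y \<in> carrier R" using y(1) by (simp add: int_closure_def)
  obtain n a where n: "1 \<le> n" and a: "\<And>i. i \<in> {1..n} \<Longrightarrow> a i \<in> ideal_pow R J i"
    and eq: "y [^] n \<oplus> finsum R (\<lambda>i. a i \<otimes> y [^] (n - i)) {1..n} = \<zero>" (is "_ \<oplus> ?sum = \<zero>")
    using y(1) unfolding int_closure_def by blast
  have "a i \<otimes> y [^] (n - i) \<in> filt_strict (real n * wt f)" if i: "i \<in> {1..n}" for i
  proof -
    have "a i \<in> filt (real i * c)"
      using a[OF i] ideal_pow_subset_filtration[of filt J c i] J(2) filt_prod filt_zero by blast
    moreover have "y [^] (n - i) \<in> filt (real (n - i) * wt f)"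
      using leading_term_in_filt[OF has_leading_term_pow[OF y(2), of "n - i"]] by (simp add: wt_mult)
    ultimately have "a i \<otimes> y [^] (n - i) \<in> filt (real i * c + real (n - i) * wt f)"
      by (rule filt_mult)
    moreover have "real n * wt f < real i * c + real (n - i) * wt f"
      using i \<open>\<not> c \<le> wt f\<close> by (simp add: of_nat_diff algebra_simps)
    ultimately show ?thesis using filt_subset_filt_strict by blast
  qed
  then have sum: "?sum \<in> filt_strict (real n * wt f)"
    by (intro finsum_in_ideal[OF mon_ideal_ideal]) auto
  have sum_closed: "?sum \<in> carrier R" by (rule mon_ideal_carrier[OF sum])
  have "y [^] n = \<zero> \<ominus> ?sum"
    using minus_equality[OF eq] sum_closed y_closed by (simp add: minus_eq)
  then have "y [^] n \<in> filt_strict (real n * wt f)"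
    using ideal_minus_closed[OF mon_ideal_ideal ideal_zero_closed[OF mon_ideal_ideal] sum] by simp
  then show False
    using leading_term_notin_filt_strict[OF has_leading_term_pow[OF y(2), of n]] by (simp add: wt_mult)
qed

end

section \<open>Dilated Newton polyhedra\<close>

definition dilated_exponents :: "nat set \<Rightarrow> (nat \<Rightarrow> nat) set \<Rightarrow> real \<Rightarrow> (nat \<Rightarrow> nat) set" where
  "dilated_exponents S A c = {e. \<exists>lam. (\<forall>a\<in>A. 0 \<le> lam a) \<and> (\<Sum>a\<in>A. lam a) = c \<and>
     (\<forall>i\<in>S. (\<Sum>a\<in>A. lam a * real (a i)) \<le> real (e i))}"

lemma dilated_exponentsI:
  assumes "\<And>a. a \<in> A \<Longrightarrow> 0 \<le> lam a" "(\<Sum>a\<in>A. lam a) = c"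
    "\<And>i. i \<in> S \<Longrightarrow> (\<Sum>a\<in>A. lam a * real (a i)) \<le> real (e i)"
  shows "e \<in> dilated_exponents S A c"
  unfolding dilated_exponents_def using assms by blast

lemma dilated_exponentsE:
  assumes "e \<in> dilated_exponents S A c"
  obtains lam where "\<And>a. a \<in> A \<Longrightarrow> 0 \<le> lam a" "(\<Sum>a\<in>A. lam a) = c"
    "\<And>i. i \<in> S \<Longrightarrow> (\<Sum>a\<in>A. lam a * real (a i)) \<le> real (e i)"
  using assms unfolding dilated_exponents_def by blast

lemma dilated_exponents_cong:
  assumes "e \<in> dilated_exponents S A c" "\<And>i. i \<in> S \<Longrightarrow> e i = f i"
  shows "f \<in> dilated_exponents S A c"
  using assms unfolding dilated_exponents_def by simp

lemma zero_in_dilated_exponents_0: "0 \<in> dilated_exponents S A 0"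
  by (rule dilated_exponentsI[of A "\<lambda>_. 0"]) auto

lemma dilated_exponents_add:
  "dilated_exponents S A c + dilated_exponents S A c' \<subseteq> dilated_exponents S A (c + c')"
proof
  fix g assume "g \<in> dilated_exponents S A c + dilated_exponents S A c'"
  then obtain e f where e: "e \<in> dilated_exponents S A c" and f: "f \<in> dilated_exponents S A c'"
    and g: "g = e + f"
    by (rule set_plus_elim)
  obtain lam where lam: "\<And>a. a \<in> A \<Longrightarrow> 0 \<le> lam a" "(\<Sum>a\<in>A. lam a) = c"
    "\<And>i. i \<in> S \<Longrightarrow> (\<Sum>a\<in>A. lam a * real (a i)) \<le> real (e i)"
    using dilated_exponentsE[OF e] by blast
  obtain mu where mu: "\<And>a. a \<in> A \<Longrightarrow> 0 \<le> mu a" "(\<Sum>a\<in>A. mu a) = c'"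
    "\<And>i. i \<in> S \<Longrightarrow> (\<Sum>a\<in>A. mu a * real (a i)) \<le> real (f i)"
    using dilated_exponentsE[OF f] by blast
  show "g \<in> dilated_exponents S A (c + c')"
    unfolding g using lam mu
    by (intro dilated_exponentsI[of A "\<lambda>a. lam a + mu a"])
      (auto simp: sum.distrib distrib_right intro: add_mono)
qed

lemma sum_decrease_coefficient:
  fixes lam h :: "'a \<Rightarrow> real"
  assumes "finite A" "a \<in> A"
  shows "(\<Sum>b\<in>A. (lam(a := lam a - 1)) b * h b) = (\<Sum>b\<in>A. lam b * h b) - h a"
proof -
  have "(\<Sum>b\<in>A - {a}. (lam(a := lam a - 1)) b * h b) = (\<Sum>b\<in>A - {a}. lam b * h b)"
    by (rule sum.cong) auto
  then show ?thesis
    using sum.remove[OF assms, of "\<lambda>b. (lam(a := lam a - 1)) b * h b"]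
      sum.remove[OF assms, of "\<lambda>b. lam b * h b"]
    by (simp add: left_diff_distrib)
qed

text \<open>By the pigeonhole principle, one of the coefficients is at least \<open>1\<close>.\<close>

lemma dilated_exponents_split:
  assumes A: "finite A" "A \<noteq> {}" "real (card A) \<le> c + 1" and e: "e \<in> dilated_exponents S A (c + 1)"
  obtains a f where "a \<in> A" "f \<in> dilated_exponents S A c" "\<And>i. i \<in> S \<Longrightarrow> e i = a i + f i"
proof -
  obtain lam where lam: "\<And>a. a \<in> A \<Longrightarrow> 0 \<le> lam a" "(\<Sum>a\<in>A. lam a) = c + 1"
    "\<And>i. i \<in> S \<Longrightarrow> (\<Sum>a\<in>A. lam a * real (a i)) \<le> real (e i)"
    using dilated_exponentsE[OF e] by blast
  have "\<exists>a\<in>A. 1 \<le> lam a"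
  proof (rule ccontr)
    assume "\<not> (\<exists>a\<in>A. 1 \<le> lam a)"
    then have "lam a < 1" if "a \<in> A" for a using that by (meson not_less)
    then have "(\<Sum>a\<in>A. lam a) < (\<Sum>a\<in>A. 1)" by (rule sum_strict_mono[OF A(1,2)])
    then show False using lam(2) A(3) by simp
  qed
  then obtain a where a: "a \<in> A" "1 \<le> lam a" by blast
  define mu where "mu = lam(a := lam a - 1)"
  have mu_sum: "(\<Sum>b\<in>A. mu b * h b) = (\<Sum>b\<in>A. lam b * h b) - h a" for h
    unfolding mu_def by (rule sum_decrease_coefficient[OF A(1) a(1)])
  have mu_nonneg: "0 \<le> mu b" if "b \<in> A" for b using lam(1)[OF that] a(2) by (simp add: mu_def)
  have le: "real (a i) + (\<Sum>b\<in>A. mu b * real (b i)) \<le> real (e i)" if "i \<in> S" for i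
    using lam(3)[OF that] mu_sum[of "\<lambda>b. real (b i)"] by linarith
  have a_le: "a i \<le> e i" if "i \<in> S" for i
  proof -
    have "0 \<le> (\<Sum>b\<in>A. mu b * real (b i))" using mu_nonneg by (intro sum_nonneg) auto
    then show ?thesis using le[OF that] by linarith
  qed
  show thesis
  proof (rule that[OF a(1), of "e - a"])
    show "e - a \<in> dilated_exponents S A c"
      using mu_nonneg mu_sum[of "\<lambda>_. 1"] lam(2) le a_le
      by (intro dilated_exponentsI[of A mu]) (auto simp: of_nat_diff le_diff_eq add.commute)
    show "e i = a i + (e - a) i" if "i \<in> S" for i using a_le[OF that] by simp
  qed
qed

lemma dilated_exponents_nonempty:
  assumes "finite A" "A \<noteq> {}"
  shows "dilated_exponents S A (real n) \<noteq> {}"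
proof -
  obtain b where b: "b \<in> A" using assms(2) by blast
  have "(\<lambda>i. n * b i) \<in> dilated_exponents S A (real n)"
    by (rule dilated_exponentsI[of A "\<lambda>a. if a = b then real n else 0"])
      (use assms(1) b in \<open>auto simp: if_distrib[where f = "\<lambda>z. z * _"] cong: if_cong\<close>)
  then show ?thesis by blast
qed

lemma dilated_exponents_extend:
  assumes "S \<subseteq> T" "b \<in> dilated_exponents S A c"
  obtains e where "e \<in> dilated_exponents T A c" "\<And>i. i \<in> S \<Longrightarrow> e i = b i"
proof -
  obtain lam where lam: "\<And>a. a \<in> A \<Longrightarrow> 0 \<le> lam a" "(\<Sum>a\<in>A. lam a) = c"
    "\<And>i. i \<in> S \<Longrightarrow> (\<Sum>a\<in>A. lam a * real (a i)) \<le> real (b i)"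
    using dilated_exponentsE[OF assms(2)] by blast
  define e where "e i = (if i \<in> S then b i else nat \<lceil>\<Sum>a\<in>A. lam a * real (a i)\<rceil>)" for i
  have "e \<in> dilated_exponents T A c"
    by (rule dilated_exponentsI[of A lam]) (use lam in \<open>auto simp: e_def real_nat_ceiling_ge\<close>)
  then show thesis using that by (simp add: e_def)
qed

lemma exists_generic_separating_weights:
  assumes "finite S" "finite A" "0 \<le> c" and b: "b \<notin> dilated_exponents S A c"
  obtains l where "generic_weights S l"
    "\<And>a. a \<in> A \<Longrightarrow> (\<Sum>i\<in>S. l i * real (b i)) < c * (\<Sum>i\<in>S. l i * real (a i))"
proof -
  define v where "v a i = c * real (a i) - real (b i)" for a :: "nat \<Rightarrow> nat" and i
  have "\<exists>i\<in>S. 0 < (\<Sum>a\<in>A. lam a * v a i)"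
    if lam: "\<forall>a\<in>A. 0 \<le> lam a" "0 < (\<Sum>a\<in>A. lam a)" for lam
  proof (rule ccontr)
    assume nonpos: "\<not> (\<exists>i\<in>S. 0 < (\<Sum>a\<in>A. lam a * v a i))"
    define total where "total = (\<Sum>a\<in>A. lam a)"
    have "b \<in> dilated_exponents S A c"
    proof (rule dilated_exponentsI[of A "\<lambda>a. c * lam a / total"])
      show "(\<Sum>a\<in>A. c * lam a / total) = c"
        using lam(2) by (simp add: total_def flip: sum_distrib_left sum_divide_distrib)
      fix i assume "i \<in> S"
      then have "(\<Sum>a\<in>A. lam a * v a i) \<le> 0" using nonpos by (meson not_less)
      moreover have "(\<Sum>a\<in>A. lam a * v a i) = (\<Sum>a\<in>A. c * lam a * real (a i)) - total * real (b i)"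
        unfolding total_def v_def sum_distrib_right sum_subtractf[symmetric]
        by (rule sum.cong) (auto simp: algebra_simps)
      ultimately have "(\<Sum>a\<in>A. c * lam a * real (a i)) / total \<le> real (b i)"
        using lam(2) by (simp add: total_def divide_le_eq mult.commute)
      then show "(\<Sum>a\<in>A. c * lam a / total * real (a i)) \<le> real (b i)" by (simp add: sum_divide_distrib)
    qed (use lam assms(3) in \<open>auto simp: total_def\<close>)
    then show False using b by simp
  qed
  then obtain l where l: "generic_weights S l" "\<And>a. a \<in> A \<Longrightarrow> 0 < (\<Sum>i\<in>S. l i * v a i)"
    using Ville_alternative_generic[OF assms(1,2), of v] by blast
  have "(\<Sum>i\<in>S. l i * v a i) = c * (\<Sum>i\<in>S. l i * real (a i)) - (\<Sum>i\<in>S. l i * real (b i))" for a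
    unfolding v_def sum_distrib_left sum_subtractf[symmetric]
    by (rule sum.cong) (auto simp: algebra_simps)
  then show thesis using that[OF l(1)] l(2) by simp
qed

section \<open>Rational powers of monomial ideals\<close>

context noetherian_monomial_system
begin

abbreviation dilated_ideal :: "(nat \<Rightarrow> nat) set \<Rightarrow> real \<Rightarrow> 'a set" where
  "dilated_ideal A c \<equiv> mon_ideal (dilated_exponents {..<d} A c)"

lemma dilated_ideal_0: "dilated_ideal A 0 = carrier R"
  by (rule mon_ideal_eq_carrier[OF zero_in_dilated_exponents_0]) simp

lemma dilated_ideal_prod: "(dilated_ideal A c) \<cdot> (dilated_ideal A c') \<subseteq> dilated_ideal A (c + c')"
  unfolding mon_ideal_prod by (rule mon_ideal_mono[OF dilated_exponents_add])

lemma dilated_ideal_Suc_subset: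
  assumes "finite A" "A \<noteq> {}" "real (card A) \<le> c + 1"
  shows "dilated_ideal A (c + 1) \<subseteq> (mon_ideal A) \<cdot> (dilated_ideal A c)"
  unfolding mon_ideal_prod
proof (rule mon_ideal_subset)
  fix e assume "e \<in> dilated_exponents {..<d} A (c + 1)"
  then obtain a f where "a \<in> A" "f \<in> dilated_exponents {..<d} A c" "\<And>i. i \<in> {..<d} \<Longrightarrow> e i = a i + f i"
    using dilated_exponents_split[OF assms] by blast
  then show "\<exists>h\<in>A + dilated_exponents {..<d} A c. \<forall>i<d. h i \<le> e i"
    by (intro bexI[of _ "a + f"] set_plus_intro) auto
qed

lemma dilated_ideal_add_subset:
  assumes "finite A" "A \<noteq> {}" "real (card A) \<le> c + 1"
  shows "dilated_ideal A (c + real n) \<subseteq> ideal_pow R (mon_ideal A) n \<cdot> (dilated_ideal A c)"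
proof (induction n)
  case 0
  then show ?case
    using ideal_prod_commute[OF oneideal mon_ideal_ideal] by (simp add: ideal_prod_one)
next
  case (Suc n)
  have "dilated_ideal A (c + real n + 1) \<subseteq> (mon_ideal A) \<cdot> (dilated_ideal A (c + real n))"
    using assms by (intro dilated_ideal_Suc_subset) auto
  also have "\<dots> \<subseteq> (mon_ideal A) \<cdot> (ideal_pow R (mon_ideal A) n \<cdot> (dilated_ideal A c))"
    by (rule ideal_prod_mono[OF order_refl Suc])
  also have "\<dots> = ideal_pow R (mon_ideal A) (Suc n) \<cdot> (dilated_ideal A c)"
    by (simp add: ideal_prod_assoc ideal_pow_ideal)
  finally show ?case by (simp add: algebra_simps)
qed

lemma dilated_ideal_nonzero:
  assumes "finite A" "A \<noteq> {}"
  shows "dilated_ideal A (real n) \<noteq> {\<zero>}"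
proof -
  obtain e where "e \<in> dilated_exponents {..<d} A (real n)"
    using dilated_exponents_nonempty[OF assms] by blast
  then have "mon e \<in> dilated_ideal A (real n)" by (rule mon_in_mon_ideal) simp
  moreover have "mon e \<noteq> \<zero>" using mon_notin_mon_ideal[of "{}" e] by (auto simp: Idl_empty)
  ultimately show ?thesis by blast
qed

lemma dilated_ideal_subset_int_closure:
  assumes "finite A" "A \<noteq> {}"
  shows "dilated_ideal A (real p) \<subseteq> int_closure R (ideal_pow R (mon_ideal A) p)"
proof
  fix y assume y: "y \<in> dilated_ideal A (real p)"
  let ?H = "dilated_ideal A (real (card A))"
  show "y \<in> int_closure R (ideal_pow R (mon_ideal A) p)"
  proof (rule determinant_trick)
    show "y \<otimes> h \<in> ideal_pow R (mon_ideal A) p \<cdot> ?H" if "h \<in> ?H" for h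
    proof -
      have "y \<otimes> h \<in> dilated_ideal A (real (card A) + real p)"
        using subsetD[OF dilated_ideal_prod ideal_prod.prod[OF y that]] by (simp add: add.commute)
      then show ?thesis using dilated_ideal_add_subset[OF assms, of "real (card A)" p] by auto
    qed
  qed (use y mon_ideal_carrier dilated_ideal_nonzero[OF assms] in \<open>auto intro: ideal_pow_ideal\<close>)
qed

lemma pow_in_dilated_ideal:
  assumes "r \<in> dilated_ideal A c"
  shows "r [^] n \<in> dilated_ideal A (real n * c)"
proof -
  have "ideal_pow R (dilated_ideal A c) n \<subseteq> dilated_ideal A (real n * c)"
    by (rule ideal_pow_subset_filtration[of "dilated_ideal A"])
      (auto simp: dilated_ideal_0 dilated_ideal_prod)
  then show ?thesis using pow_in_ideal_pow[OF mon_ideal_ideal assms] by blast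
qed

lemma integral_power_in_dilated_ideal:
  assumes A: "finite A" "A \<noteq> {}" and "0 < q" and r: "r \<in> carrier R"
    and integral: "r [^] q \<in> int_closure R (ideal_pow R (mon_ideal A) p)"
  shows "r \<in> dilated_ideal A (real p / real q)"
proof (rule ccontr)
  let ?w = "real p / real q"
  assume r_notin_dilated: "r \<notin> dilated_ideal A ?w"
  obtain S b where S: "S \<subseteq> {..<d}"
    and b: "\<And>g. g \<in> dilated_exponents {..<d} A ?w \<Longrightarrow> \<exists>i\<in>S. b i < g i"
    and r_notin: "r \<notin> mon_ideal (irreducible_exponents S b)"
    using irreducible_component[OF r r_notin_dilated] by blast
  have b_notin: "b \<notin> dilated_exponents S A ?w"
    using dilated_exponents_extend[OF S] b by (metis less_irrefl)
  have "finite S" "0 \<le> ?w" using S finite_subset by auto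
  then obtain l where l: "generic_weights S l"
    "\<And>a. a \<in> A \<Longrightarrow> (\<Sum>i\<in>S. l i * real (b i)) < ?w * (\<Sum>i\<in>S. l i * real (a i))"
    using exists_generic_separating_weights[OF _ A(1) _ b_notin] by blast
  interpret weighted_monomial_system R x d S l by unfold_locales (fact S l(1))+
  define m where "m = Min (wt ` A)"
  have "m \<in> wt ` A" unfolding m_def using A by (intro Min_in) auto
  then have "wt b < ?w * m" using l(2) unfolding wt_def by auto
  then have wt_b: "real q * wt b < real p * m" using \<open>0 < q\<close> by (simp add: field_simps)
  have "filt_strict (wt b) \<subseteq> mon_ideal (irreducible_exponents S b)"
  proof (rule mon_ideal_subset)
    fix g assume "g \<in> {e. wt b < wt e}"
    then obtain i where "i \<in> S" "b i < g i" using wt_less_imp by blast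
    then show "\<exists>h\<in>irreducible_exponents S b. \<forall>j<d. h j \<le> g j"
      by (intro bexI[of _ "single_exponent i (Suc (b i))"]) auto
  qed
  then obtain u f where f: "has_leading_term r u f" "wt f \<le> wt b"
    using exists_leading_term[OF r, of b] r_notin by blast
  have "mon_ideal A \<subseteq> filt m" unfolding m_def using A(1) by (intro mon_ideal_mono) auto
  then have "ideal_pow R (mon_ideal A) p \<subseteq> filt (real p * m)"
    using ideal_pow_subset_filtration[of filt] filt_zero filt_prod by blast
  then have "real p * m \<le> wt (\<lambda>i. q * f i)"
    using integral has_leading_term_pow[OF f(1)]
    by (intro integral_weight_bound[OF ideal_pow_ideal[OF mon_ideal_ideal]])
  also have "\<dots> \<le> real q * wt b" using f(2) by (simp add: wt_mult mult_left_mono)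
  finally show False using wt_b by simp
qed

theorem rational_power_eq_dilated_ideal:
  assumes "finite A" "A \<noteq> {}" "0 < q"
  shows "{r \<in> carrier R. r [^] q \<in> int_closure R (ideal_pow R (mon_ideal A) p)} =
    dilated_ideal A (real p / real q)"
proof (intro equalityI subsetI)
  fix r assume r: "r \<in> dilated_ideal A (real p / real q)"
  then have "r [^] q \<in> dilated_ideal A (real p)" using pow_in_dilated_ideal[OF r, of q] assms(3) by simp
  then show "r \<in> {r \<in> carrier R. r [^] q \<in> int_closure R (ideal_pow R (mon_ideal A) p)}"
    using dilated_ideal_subset_int_closure[OF assms(1,2)] mon_ideal_carrier[OF r] by blast
qed (use integral_power_in_dilated_ideal[OF assms] in blast)

end

section \<open>Newton polyhedra and generalized regular systems of parameters\<close>

lemma scaled_newton_polyhedron_imp_dilated: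
  assumes "0 \<le> c" "(\<lambda>i. real (e i)) \<in> scale_set c (newton_polyhedron d A)"
  shows "e \<in> dilated_exponents {..<d} A c"
proof -
  obtain y lam where y: "(\<lambda>i. real (e i)) = (\<lambda>i. c * y i)" "\<forall>a\<in>A. 0 \<le> lam a" "(\<Sum>a\<in>A. lam a) = 1"
    "\<forall>i<d. (\<Sum>a\<in>A. lam a * real (a i)) \<le> y i"
    using assms(2) unfolding scale_set_def newton_polyhedron_def by blast
  show ?thesis
  proof (rule dilated_exponentsI[of A "\<lambda>a. c * lam a"])
    fix i assume "i \<in> {..<d}"
    then have "c * (\<Sum>a\<in>A. lam a * real (a i)) \<le> c * y i"
      using y(4) assms(1) by (intro mult_left_mono) auto
    then show "(\<Sum>a\<in>A. c * lam a * real (a i)) \<le> real (e i)"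
      using fun_cong[OF y(1), of i] by (simp add: sum_distrib_left mult.assoc)
  qed (use y(2,3) assms(1) in \<open>auto simp flip: sum_distrib_left\<close>)
qed

lemma dilated_imp_scaled_newton_polyhedron:
  assumes "0 < c" "\<forall>i\<ge>d. e i = 0" "e \<in> dilated_exponents {..<d} A c"
  shows "(\<lambda>i. real (e i)) \<in> scale_set c (newton_polyhedron d A)"
proof -
  obtain lam where lam: "\<And>a. a \<in> A \<Longrightarrow> 0 \<le> lam a" "(\<Sum>a\<in>A. lam a) = c"
    "\<And>i. i \<in> {..<d} \<Longrightarrow> (\<Sum>a\<in>A. lam a * real (a i)) \<le> real (e i)"
    using dilated_exponentsE[OF assms(3)] by blast
  have "(\<lambda>i. real (e i) / c) \<in> newton_polyhedron d A"
    unfolding newton_polyhedron_def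
  proof (intro CollectI conjI exI[of _ "\<lambda>a. lam a / c"] allI impI ballI)
    show "(\<Sum>a\<in>A. lam a / c) = 1" using lam(2) assms(1) by (simp flip: sum_divide_distrib)
    show "(\<Sum>a\<in>A. lam a / c * real (a i)) \<le> real (e i) / c" if "i < d" for i
      using divide_right_mono[OF lam(3), of i c] that assms(1) by (simp add: sum_divide_distrib)
  qed (use assms(1,2) lam(1) in auto)
  then show ?thesis
    unfolding scale_set_def using assms(1) by (intro image_eqI[of _ _ "\<lambda>i. real (e i) / c"]) auto
qed

lemma zero_in_scale_set_0:
  assumes "finite A" "A \<noteq> {}"
  shows "(\<lambda>_. 0) \<in> scale_set 0 (newton_polyhedron d A)"
proof -
  obtain a where "a \<in> A" using assms(2) by blast
  then have "(\<lambda>i. if i < d then real (a i) else 0) \<in> newton_polyhedron d A"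
    unfolding newton_polyhedron_def using assms(1)
    by (intro CollectI conjI exI[of _ "\<lambda>b. if b = a then 1 else 0"])
      (auto simp: if_distrib[where f = "\<lambda>z. z * _"] cong: if_cong)
  then show ?thesis unfolding scale_set_def by force
qed

lemma (in noetherian_monomial_system) mon_ideal_scaled_newton_polyhedron:
  assumes "finite A" "A \<noteq> {}" "0 \<le> c"
  shows "mon_ideal {e. (\<forall>i\<ge>d. e i = 0) \<and> (\<lambda>i. real (e i)) \<in> scale_set c (newton_polyhedron d A)} =
    dilated_ideal A c"
    (is "mon_ideal ?E = _")
proof
  show "mon_ideal ?E \<subseteq> dilated_ideal A c"
    using scaled_newton_polyhedron_imp_dilated[OF assms(3)] by (intro mon_ideal_mono) blast
  show "dilated_ideal A c \<subseteq> mon_ideal ?E"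
  proof (rule mon_ideal_subset)
    fix e assume e: "e \<in> dilated_exponents {..<d} A c"
    show "\<exists>h\<in>?E. \<forall>i<d. h i \<le> e i"
    proof (cases "c = 0")
      case True
      then show ?thesis using zero_in_scale_set_0[OF assms(1,2)] by (intro bexI[of _ "\<lambda>_. 0"]) auto
    next
      case False
      let ?e = "\<lambda>i. if i < d then e i else 0"
      have "?e \<in> dilated_exponents {..<d} A c" by (rule dilated_exponents_cong[OF e]) simp
      then have "(\<lambda>i. real (?e i)) \<in> scale_set c (newton_polyhedron d A)"
        using False assms(3) by (intro dilated_imp_scaled_newton_polyhedron) auto
      then show ?thesis by (intro bexI[of _ ?e]) auto
    qed
  qed
qed

lemma rat_power_closure_eq:
  assumes "0 \<le> w"
  obtains p q :: nat where "0 < q" "of_rat w = real p / real q"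
    "\<And>I. rat_power_closure R I w = {r \<in> carrier R. r [^]\<^bsub>R\<^esub> q \<in> int_closure R (ideal_pow R I p)}"
proof -
  obtain p q where pq: "quotient_of w = (p, q)" by fastforce
  have "0 < q" by (rule quotient_of_denom_pos[OF pq])
  have w: "w = of_int p / of_int q" by (rule quotient_of_div[OF pq])
  then have "0 \<le> p" using assms \<open>0 < q\<close> by (simp add: zero_le_divide_iff)
  show thesis
  proof (rule that[of "nat q" "nat p"])
    show "of_rat w = real (nat p) / real (nat q)"
      unfolding w using \<open>0 \<le> p\<close> \<open>0 < q\<close> by (simp add: of_rat_divide)
  qed (use \<open>0 < q\<close> in \<open>simp_all add: rat_power_closure_def pq\<close>)
qed

lemma exists_permutation_initial:
  assumes "S \<subseteq> {..<d}" "i < d" "i \<notin> S"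
  obtains \<sigma> where "\<sigma> permutes {..<d}" "\<sigma> ` {..<card S} = S" "\<sigma> (card S) = i" "card S < d"
proof -
  have finS: "finite S" using assms(1) finite_subset by blast
  define xs where "xs = sorted_list_of_set S @ [i] @ sorted_list_of_set ({..<d} - insert i S)"
  have xs: "distinct xs" "set xs = {..<d}" using assms finS by (auto simp: xs_def)
  have length: "length xs = d" using distinct_card[OF xs(1)] xs(2) by simp
  define \<sigma> where "\<sigma> j = (if j < d then xs ! j else j)" for j
  have "bij_betw ((!) xs) {..<d} {..<d}" by (rule bij_betw_nth[OF xs(1)]) (simp_all add: length xs(2))
  then have "bij_betw \<sigma> {..<d} {..<d}" by (rule bij_betw_cong[THEN iffD1, rotated]) (simp add: \<sigma>_def)
  then have permutes: "\<sigma> permutes {..<d}" by (rule bij_imp_permutes) (simp add: \<sigma>_def)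
  have less: "card S < d" using assms finS psubset_card_mono[of "{..<d}" S] by auto
  have "\<sigma> ` {..<card S} = (!) xs ` {0..<card S}" using less by (intro image_cong) (auto simp: \<sigma>_def)
  also have "\<dots> = set (take (card S) xs)" by (rule nth_image) (use less length in simp)
  also have "\<dots> = S" using finS by (simp add: xs_def)
  finally have "\<sigma> ` {..<card S} = S" .
  moreover have "\<sigma> (card S) = i" using less finS by (simp add: \<sigma>_def xs_def nth_append)
  ultimately show thesis using that permutes less by blast
qed

lemma permutable_regular_seq_notin:
  fixes R (structure)
  assumes "ring R" "permutable_regular_seq R x d" "S \<subseteq> {..<d}" "i < d" "i \<notin> S"
    and proper: "\<one> \<notin> Idl (x ` S)"
  shows "x i \<notin> Idl (x ` S)"
proof
  interpret ring R by (rule assms(1))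
  assume "x i \<in> Idl (x ` S)"
  obtain \<sigma> where \<sigma>: "\<sigma> permutes {..<d}" "\<sigma> ` {..<card S} = S" "\<sigma> (card S) = i" "card S < d"
    by (rule exists_permutation_initial[OF assms(3-5)])
  have regular: "regular_seq R (x \<circ> \<sigma>) d"
    using assms(2) \<sigma>(1) unfolding permutable_regular_seq_def by blast
  have "(x \<circ> \<sigma>) ` {..<card S} = x ` S" using \<sigma>(2) by (metis image_comp)
  moreover have "x i \<in> carrier R" using regular \<sigma>(3,4) unfolding regular_seq_def by (metis comp_apply)
  ultimately have "\<one> \<in> Idl (x ` S)"
    using regular \<sigma>(3,4) \<open>x i \<in> Idl (x ` S)\<close> unfolding regular_seq_def
    by (metis comp_apply one_closed r_one)
  with proper show False ..
qed

lemma gen_reg_sop_noetherian_monomial_system: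
  fixes R (structure)
  assumes R: "regular_domain R" and x: "gen_reg_sop R x d"
  shows "noetherian_monomial_system R x d"
proof -
  have "noetherian_ring R" "domain R" using R by (auto simp: regular_domain_def regular_ring_def)
  then interpret noetherian_domain R by (rule noetherian_domain.intro)
  have permutable: "permutable_regular_seq R x d" using x by (simp add: gen_reg_sop_def)
  then have "regular_seq R (x \<circ> id) d" using permutes_id unfolding permutable_regular_seq_def by blast
  then have x_closed: "x i \<in> carrier R" if "i < d" for i using that by (auto simp: regular_seq_def)
  have ideal: "ideal (Idl (x ` S)) R" if "S \<subseteq> {..<d}" for S
    by (rule genideal_ideal) (use x_closed that in auto)
  have prime: "primeideal (Idl (x ` S)) R" if S: "S \<subseteq> {..<d}" for S
    using x S unfolding gen_reg_sop_def regular_domain_def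
    by (intro quot_domain_imp_primeideal ideal) auto
  have proper: "\<one> \<notin> Idl (x ` S)" if "S \<subseteq> {..<d}" for S
    using ideal.one_imp_carrier[OF ideal[OF that]] primeideal.I_notcarr[OF prime[OF that]] by auto
  show ?thesis
    by (intro noetherian_monomial_system.intro monomial_system.intro monomial_system_axioms.intro
        noetherian_domain_axioms cring_axioms x_closed prime
        permutable_regular_seq_notin[OF ring_axioms permutable] proper)
qed

theorem theorem5p5:
  fixes R :: "('a, 'b) ring_scheme" and x :: "nat \<Rightarrow> 'a" and d :: nat
    and A :: "(nat \<Rightarrow> nat) set" and w :: rat
  assumes "regular_domain R"
    and "gen_reg_sop R x d"
    and "finite A" and "A \<noteq> {}"
    and "\<forall>a\<in>A. \<forall>i\<ge>d. a i = 0"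
    and "w \<ge> 0"
  shows "rat_power_closure R (genideal R (monomial R x d ` A)) w =
         genideal R {monomial R x d e | e. (\<forall>i\<ge>d. e i = 0) \<and>
            (\<lambda>i. real (e i)) \<in> scale_set (of_rat w) (newton_polyhedron d A)}"
proof -
  interpret noetherian_monomial_system R x d
    by (rule gen_reg_sop_noetherian_monomial_system[OF assms(1,2)])
  obtain p q :: nat where "0 < q" and w: "of_rat w = real p / real q"
    and power: "\<And>I. rat_power_closure R I w =
      {r \<in> carrier R. r [^]\<^bsub>R\<^esub> q \<in> int_closure R (ideal_pow R I p)}"
    by (rule rat_power_closure_eq[OF assms(6)]) blast
  have "rat_power_closure R (mon_ideal A) w = dilated_ideal A (of_rat w)"
    unfolding power w by (rule rational_power_eq_dilated_ideal[OF assms(3,4) \<open>0 < q\<close>])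
  also have "\<dots> = mon_ideal {e. (\<forall>i\<ge>d. e i = 0) \<and>
      (\<lambda>i. real (e i)) \<in> scale_set (of_rat w) (newton_polyhedron d A)}"
    using assms(6) by (intro mon_ideal_scaled_newton_polyhedron[OF assms(3,4), symmetric]) simp
  finally show ?thesis by (simp add: image_Collect)
qed

end
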